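(* Let $I$ be the pullback shape category $\{\bullet\to\bullet\leftarrow\bullet\}$. Let $\mathcal{A}$ be the $2$-category generated by objects $X,L,A,B,C$; morphisms $f\colon X\to L$, $\lambda_0\colon L\to B$, $\lambda_1\colon L\to C$, $\alpha_0\colon X\to B$, $\alpha_1\colon X\to C$, $b\colon B\to A$, $c\colon C\to A$; and invertible $2$-morphisms $\gamma_0\colon\lambda_0 f\Rightarrow\alpha_0$ and $\gamma_1\colon\lambda_1 f\Rightarrow\alpha_1$; subject to the relations $b\lambda_0=c\lambda_1$ and $b\alpha_0=c\alpha_1$. Let $F\colon I\to\mathcal{A}$ be the diagram $B\xrightarrow{b}A\xleftarrow{c}C$, and let $\lambda\colon\Delta L\Rightarrow F$ be the $2$-cone with components $\lambda_0$ at $B$, $\lambda_1$ at $C$ and $b\lambda_0=c\lambda_1$ at $A$. Then $(L,\lambda)$ is $2$-terminal in the pseudo-slice $\Delta\downarrow_p F$ of $2$-cones over $F$, but it is not a $2$-limit of $F$.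
   Context: $2$-categories and $2$-functors are strict; $*$ denotes horizontal composition (and whiskering) of $2$-morphisms and juxtaposition denotes vertical composition. "Generated by the data subject to relations" means the $2$-category freely generated by the listed objects, morphisms and $2$-morphisms (with a formal inverse adjoined for each $2$-morphism declared invertible), modulo the listed relations. The $1$-category $I$ is regarded as a $2$-category with only identity $2$-morphisms. A $2$-natural transformation $\mu\colon F\Rightarrow G$ between $2$-functors $F,G\colon I\to\mathcal{A}$ consists of morphisms $\mu_i\colon Fi\to Gi$ with $(Gf)\mu_i=\mu_j(Ff)$ for every $f\colon i\to j$ in $I$ and $G\alpha*\mu_i=\mu_j*F\alpha$ for every $2$-morphism $\alpha$ in $I$. A modification $\varphi\colon\mu\to\nu$ consists of $2$-morphisms $\varphi_i\colon\mu_i\Rightarrow\nu_i$ with $Gf*\varphi_i=\varphi_j*Ff$ for every $f\colon i\to j$. $[I,\mathcal{A}]$ is the $2$-category of $2$-functors, $2$-natural transformations and modifications; $\Delta X$ is the constant $2$-functor at $X$; a $2$-cone over $F$ is a $2$-natural transformation $\Delta X\Rightarrow F$. A $2$-limit of $F$ is a pair $(L,\lambda\colon\Delta L\Rightarrow F)$ with $\lambda$ a $2$-cone such that for each $X\in\mathcal{A}$ the functor $\lambda_*\circ\Delta\colon\mathcal{A}(X,L)\to[I,\mathcal{A}](\Delta X,F)$, given by post-composition with $\lambda$, is an isomorphism of categories. The pseudo-slice $\Delta\downarrow_p F$ of $2$-cones is the $2$-category whose objects are pairs $(X,\mu)$ with $\mu\colon\Delta X\Rightarrow F$ a $2$-cone;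 morphisms $(X,\mu)\to(Y,\nu)$ are pairs $(f,\varphi)$ of a morphism $f\colon X\to Y$ in $\mathcal{A}$ and an invertible modification $\varphi\colon\nu\Delta f\to\mu$; $2$-morphisms $(f,\varphi)\Rightarrow(g,\psi)$ are $2$-morphisms $\alpha\colon f\Rightarrow g$ in $\mathcal{A}$ with $\psi(\nu*\Delta\alpha)=\varphi$. An object $L$ of a $2$-category $\mathcal{B}$ is $2$-terminal if for all $X\in\mathcal{B}$ the category $\mathcal{B}(X,L)$ is isomorphic to the terminal category $\mathbb{1}$.
   Formalization: The relation b*γ₀ = c*γ₁ between 2-morphisms is added to the presentation of 𝒜; without it no invertible modification λΔf → α exists (its components would need b*φ_B = c*φ_C), so (L,λ) would not be 2-terminal. *)

theory Defs
  imports Main "HOL-Library.FuncSet"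
begin

section \<open>Categories\<close>

record ('o, 'a) cat =
  Ob :: "'o set"
  Ar :: "'a set"
  Dom :: "'a \<Rightarrow> 'o"
  Cod :: "'a \<Rightarrow> 'o"
  Idt :: "'o \<Rightarrow> 'a"
  Cmp :: "'a \<Rightarrow> 'a \<Rightarrow> 'a"

definition category :: "('o, 'a) cat \<Rightarrow> bool" where
  "category C \<longleftrightarrow>
    (\<forall>f\<in>Ar C. Dom C f \<in> Ob C \<and> Cod C f \<in> Ob C) \<and>
    (\<forall>x\<in>Ob C. Idt C x \<in> Ar C \<and> Dom C (Idt C x) = x \<and> Cod C (Idt C x) = x) \<and>
    (\<forall>g\<in>Ar C. \<forall>f\<in>Ar C. Dom C g = Cod C f \<longrightarrow>
       Cmp C g f \<in> Ar C \<and> Dom C (Cmp C g f) = Dom C f \<and> Cod C (Cmp C g f) = Cod C g) \<and>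
    (\<forall>f\<in>Ar C. Cmp C (Idt C (Cod C f)) f = f \<and> Cmp C f (Idt C (Dom C f)) = f) \<and>
    (\<forall>h\<in>Ar C. \<forall>g\<in>Ar C. \<forall>f\<in>Ar C. Dom C h = Cod C g \<longrightarrow> Dom C g = Cod C f \<longrightarrow>
       Cmp C (Cmp C h g) f = Cmp C h (Cmp C g f))"

text \<open>A functor is given by its action on objects and its action on arrows.\<close>

definition is_functor ::
  "('o, 'a) cat \<Rightarrow> ('p, 'b) cat \<Rightarrow> ('o \<Rightarrow> 'p) \<Rightarrow> ('a \<Rightarrow> 'b) \<Rightarrow> bool" where
  "is_functor C D H0 H1 \<longleftrightarrow>
    (\<forall>x\<in>Ob C. H0 x \<in> Ob D) \<and>
    (\<forall>f\<in>Ar C. H1 f \<in> Ar D \<and> Dom D (H1 f) = H0 (Dom C f) \<and> Cod D (H1 f) = H0 (Cod C f)) \<and>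
    (\<forall>x\<in>Ob C. H1 (Idt C x) = Idt D (H0 x)) \<and>
    (\<forall>g\<in>Ar C. \<forall>f\<in>Ar C. Dom C g = Cod C f \<longrightarrow> H1 (Cmp C g f) = Cmp D (H1 g) (H1 f))"

definition is_cat_iso ::
  "('o, 'a) cat \<Rightarrow> ('p, 'b) cat \<Rightarrow> ('o \<Rightarrow> 'p) \<Rightarrow> ('a \<Rightarrow> 'b) \<Rightarrow> bool" where
  "is_cat_iso C D H0 H1 \<longleftrightarrow> is_functor C D H0 H1 \<and>
    (\<exists>K0 K1. is_functor D C K0 K1 \<and>
      (\<forall>x\<in>Ob C. K0 (H0 x) = x) \<and> (\<forall>f\<in>Ar C. K1 (H1 f) = f) \<and>
      (\<forall>y\<in>Ob D. H0 (K0 y) = y) \<and> (\<forall>g\<in>Ar D. H1 (K1 g) = g))"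

definition isomorphic_cats :: "('o, 'a) cat \<Rightarrow> ('p, 'b) cat \<Rightarrow> bool" where
  "isomorphic_cats C D \<longleftrightarrow> (\<exists>H0 H1. is_cat_iso C D H0 H1)"

definition terminal_cat :: "(unit, unit) cat" where
  "terminal_cat = \<lparr>Ob = UNIV, Ar = UNIV, Dom = (\<lambda>_. ()), Cod = (\<lambda>_. ()),
     Idt = (\<lambda>_. ()), Cmp = (\<lambda>_ _. ())\<rparr>"


section \<open>Strict 2-categories\<close>

record ('o, 'm, 'c) two_cat =
  Obj :: "'o set"
  Mor :: "'m set"
  Cell :: "'c set"
  dom1 :: "'m \<Rightarrow> 'o"
  cod1 :: "'m \<Rightarrow> 'o"
  dom2 :: "'c \<Rightarrow> 'm"
  cod2 :: "'c \<Rightarrow> 'm"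
  id1 :: "'o \<Rightarrow> 'm"
  comp1 :: "'m \<Rightarrow> 'm \<Rightarrow> 'm"  (infixl "\<odot>\<index>" 70)
  id2 :: "'m \<Rightarrow> 'c"
  vcomp :: "'c \<Rightarrow> 'c \<Rightarrow> 'c"  (infixl "\<bullet>\<index>" 70)
  hcomp :: "'c \<Rightarrow> 'c \<Rightarrow> 'c"  (infixl "\<star>\<index>" 70)

locale two_category =
  fixes A :: "('o, 'm, 'c) two_cat" (structure)
  assumes mor_ends: "f \<in> Mor A \<Longrightarrow> dom1 A f \<in> Obj A \<and> cod1 A f \<in> Obj A"
    and cell_ends: "\<alpha> \<in> Cell A \<Longrightarrow> dom2 A \<alpha> \<in> Mor A \<and> cod2 A \<alpha> \<in> Mor A \<and>
      dom1 A (dom2 A \<alpha>) = dom1 A (cod2 A \<alpha>) \<and> cod1 A (dom2 A \<alpha>) = cod1 A (cod2 A \<alpha>)"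
    and id1_closed: "x \<in> Obj A \<Longrightarrow> id1 A x \<in> Mor A \<and> dom1 A (id1 A x) = x \<and> cod1 A (id1 A x) = x"
    and comp1_closed: "\<lbrakk>g \<in> Mor A; f \<in> Mor A; dom1 A g = cod1 A f\<rbrakk> \<Longrightarrow>
      g \<odot> f \<in> Mor A \<and> dom1 A (g \<odot> f) = dom1 A f \<and> cod1 A (g \<odot> f) = cod1 A g"
    and comp1_unit: "f \<in> Mor A \<Longrightarrow> id1 A (cod1 A f) \<odot> f = f \<and> f \<odot> id1 A (dom1 A f) = f"
    and comp1_assoc: "\<lbrakk>h \<in> Mor A; g \<in> Mor A; f \<in> Mor A; dom1 A h = cod1 A g; dom1 A g = cod1 A f\<rbrakk>
      \<Longrightarrow> (h \<odot> g) \<odot> f = h \<odot> (g \<odot> f)"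
    and id2_closed: "f \<in> Mor A \<Longrightarrow> id2 A f \<in> Cell A \<and> dom2 A (id2 A f) = f \<and> cod2 A (id2 A f) = f"
    and vcomp_closed: "\<lbrakk>\<beta> \<in> Cell A; \<alpha> \<in> Cell A; dom2 A \<beta> = cod2 A \<alpha>\<rbrakk> \<Longrightarrow>
      \<beta> \<bullet> \<alpha> \<in> Cell A \<and> dom2 A (\<beta> \<bullet> \<alpha>) = dom2 A \<alpha> \<and> cod2 A (\<beta> \<bullet> \<alpha>) = cod2 A \<beta>"
    and vcomp_unit: "\<alpha> \<in> Cell A \<Longrightarrow> id2 A (cod2 A \<alpha>) \<bullet> \<alpha> = \<alpha> \<and> \<alpha> \<bullet> id2 A (dom2 A \<alpha>) = \<alpha>"
    and vcomp_assoc: "\<lbrakk>\<gamma> \<in> Cell A; \<beta> \<in> Cell A; \<alpha> \<in> Cell A; dom2 A \<gamma> = cod2 A \<beta>; dom2 A \<beta> = cod2 A \<alpha>\<rbrakk>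
      \<Longrightarrow> (\<gamma> \<bullet> \<beta>) \<bullet> \<alpha> = \<gamma> \<bullet> (\<beta> \<bullet> \<alpha>)"
    and hcomp_closed: "\<lbrakk>\<beta> \<in> Cell A; \<alpha> \<in> Cell A; dom1 A (dom2 A \<beta>) = cod1 A (dom2 A \<alpha>)\<rbrakk> \<Longrightarrow>
      \<beta> \<star> \<alpha> \<in> Cell A \<and> dom2 A (\<beta> \<star> \<alpha>) = dom2 A \<beta> \<odot> dom2 A \<alpha> \<and> cod2 A (\<beta> \<star> \<alpha>) = cod2 A \<beta> \<odot> cod2 A \<alpha>"
    and hcomp_unit: "\<alpha> \<in> Cell A \<Longrightarrow> id2 A (id1 A (cod1 A (dom2 A \<alpha>))) \<star> \<alpha> = \<alpha> \<and>
      \<alpha> \<star> id2 A (id1 A (dom1 A (dom2 A \<alpha>))) = \<alpha>"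
    and hcomp_assoc: "\<lbrakk>\<gamma> \<in> Cell A; \<beta> \<in> Cell A; \<alpha> \<in> Cell A; dom1 A (dom2 A \<gamma>) = cod1 A (dom2 A \<beta>);
      dom1 A (dom2 A \<beta>) = cod1 A (dom2 A \<alpha>)\<rbrakk> \<Longrightarrow> (\<gamma> \<star> \<beta>) \<star> \<alpha> = \<gamma> \<star> (\<beta> \<star> \<alpha>)"
    and hcomp_id2: "\<lbrakk>g \<in> Mor A; f \<in> Mor A; dom1 A g = cod1 A f\<rbrakk> \<Longrightarrow> id2 A g \<star> id2 A f = id2 A (g \<odot> f)"
    and interchange: "\<lbrakk>\<beta>' \<in> Cell A; \<beta> \<in> Cell A; \<alpha>' \<in> Cell A; \<alpha> \<in> Cell A; dom2 A \<beta>' = cod2 A \<beta>;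
      dom2 A \<alpha>' = cod2 A \<alpha>; dom1 A (dom2 A \<beta>) = cod1 A (dom2 A \<alpha>)\<rbrakk> \<Longrightarrow>
      (\<beta>' \<bullet> \<beta>) \<star> (\<alpha>' \<bullet> \<alpha>) = (\<beta>' \<star> \<alpha>') \<bullet> (\<beta> \<star> \<alpha>)"

definition hom_cat :: "('o, 'm, 'c) two_cat \<Rightarrow> 'o \<Rightarrow> 'o \<Rightarrow> ('m, 'c) cat" where
  "hom_cat A x y = \<lparr>
     Ob = {f \<in> Mor A. dom1 A f = x \<and> cod1 A f = y},
     Ar = {\<alpha> \<in> Cell A. dom1 A (dom2 A \<alpha>) = x \<and> cod1 A (dom2 A \<alpha>) = y},
     Dom = dom2 A, Cod = cod2 A, Idt = id2 A, Cmp = vcomp A\<rparr>"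

definition invertible_cell :: "('o, 'm, 'c) two_cat \<Rightarrow> 'c \<Rightarrow> bool" where
  "invertible_cell A \<alpha> \<longleftrightarrow> \<alpha> \<in> Cell A \<and>
    (\<exists>\<beta>\<in>Cell A. dom2 A \<beta> = cod2 A \<alpha> \<and> cod2 A \<beta> = dom2 A \<alpha> \<and>
       \<beta> \<bullet>\<^bsub>A\<^esub> \<alpha> = id2 A (dom2 A \<alpha>) \<and> \<alpha> \<bullet>\<^bsub>A\<^esub> \<beta> = id2 A (cod2 A \<alpha>))"

definition two_terminal :: "('o, 'm, 'c) two_cat \<Rightarrow> 'o \<Rightarrow> bool" where
  "two_terminal B l \<longleftrightarrow> l \<in> Obj B \<and> (\<forall>x\<in>Obj B. isomorphic_cats (hom_cat B x l) terminal_cat)"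

definition discrete_two_cat :: "('o, 'a) cat \<Rightarrow> ('o, 'a, 'a) two_cat" where
  "discrete_two_cat C = \<lparr>Obj = Ob C, Mor = Ar C, Cell = Ar C, dom1 = Dom C, cod1 = Cod C,
     dom2 = (\<lambda>f. f), cod2 = (\<lambda>f. f), id1 = Idt C, comp1 = Cmp C,
     id2 = (\<lambda>f. f), vcomp = (\<lambda>f g. f), hcomp = Cmp C\<rparr>"

lemma two_category_discrete: "category C \<Longrightarrow> two_category (discrete_two_cat C)"
  by unfold_locales (auto simp: category_def discrete_two_cat_def)


section \<open>The 2-category of 2-functors, 2-natural transformations and modifications\<close>

text \<open>All families are required to be extensional on the relevant carrier, so that equality of
  2-functors, 2-natural transformations and modifications is equality in HOL.\<close>

record ('o, 'm, 'c, 'p, 'n, 'd) two_fun =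
  on_obj :: "'o \<Rightarrow> 'p"
  on_mor :: "'m \<Rightarrow> 'n"
  on_cell :: "'c \<Rightarrow> 'd"

record ('o, 'm, 'c, 'p, 'n, 'd) transf =
  tdom :: "('o, 'm, 'c, 'p, 'n, 'd) two_fun"
  tcod :: "('o, 'm, 'c, 'p, 'n, 'd) two_fun"
  tcmp :: "'o \<Rightarrow> 'n"

record ('o, 'm, 'c, 'p, 'n, 'd) modif =
  mdom :: "('o, 'm, 'c, 'p, 'n, 'd) transf"
  mcod :: "('o, 'm, 'c, 'p, 'n, 'd) transf"
  mcmp :: "'o \<Rightarrow> 'd"

definition two_functor ::
  "('o, 'm, 'c) two_cat \<Rightarrow> ('p, 'n, 'd) two_cat \<Rightarrow> ('o, 'm, 'c, 'p, 'n, 'd) two_fun \<Rightarrow> bool" where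
  "two_functor I A F \<longleftrightarrow>
    on_obj F \<in> extensional (Obj I) \<and> on_mor F \<in> extensional (Mor I) \<and> on_cell F \<in> extensional (Cell I) \<and>
    (\<forall>i\<in>Obj I. on_obj F i \<in> Obj A) \<and>
    (\<forall>f\<in>Mor I. on_mor F f \<in> Mor A \<and>
       dom1 A (on_mor F f) = on_obj F (dom1 I f) \<and> cod1 A (on_mor F f) = on_obj F (cod1 I f)) \<and>
    (\<forall>\<alpha>\<in>Cell I. on_cell F \<alpha> \<in> Cell A \<and>
       dom2 A (on_cell F \<alpha>) = on_mor F (dom2 I \<alpha>) \<and> cod2 A (on_cell F \<alpha>) = on_mor F (cod2 I \<alpha>)) \<and>
    (\<forall>i\<in>Obj I. on_mor F (id1 I i) = id1 A (on_obj F i)) \<and>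
    (\<forall>g\<in>Mor I. \<forall>f\<in>Mor I. dom1 I g = cod1 I f \<longrightarrow>
       on_mor F (g \<odot>\<^bsub>I\<^esub> f) = on_mor F g \<odot>\<^bsub>A\<^esub> on_mor F f) \<and>
    (\<forall>f\<in>Mor I. on_cell F (id2 I f) = id2 A (on_mor F f)) \<and>
    (\<forall>\<beta>\<in>Cell I. \<forall>\<alpha>\<in>Cell I. dom2 I \<beta> = cod2 I \<alpha> \<longrightarrow>
       on_cell F (\<beta> \<bullet>\<^bsub>I\<^esub> \<alpha>) = on_cell F \<beta> \<bullet>\<^bsub>A\<^esub> on_cell F \<alpha>) \<and>
    (\<forall>\<beta>\<in>Cell I. \<forall>\<alpha>\<in>Cell I. dom1 I (dom2 I \<beta>) = cod1 I (dom2 I \<alpha>) \<longrightarrow>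
       on_cell F (\<beta> \<star>\<^bsub>I\<^esub> \<alpha>) = on_cell F \<beta> \<star>\<^bsub>A\<^esub> on_cell F \<alpha>)"

definition two_natural ::
  "('o, 'm, 'c) two_cat \<Rightarrow> ('p, 'n, 'd) two_cat \<Rightarrow> ('o, 'm, 'c, 'p, 'n, 'd) transf \<Rightarrow> bool" where
  "two_natural I A \<mu> \<longleftrightarrow>
    two_functor I A (tdom \<mu>) \<and> two_functor I A (tcod \<mu>) \<and> tcmp \<mu> \<in> extensional (Obj I) \<and>
    (\<forall>i\<in>Obj I. tcmp \<mu> i \<in> Mor A \<and>
       dom1 A (tcmp \<mu> i) = on_obj (tdom \<mu>) i \<and> cod1 A (tcmp \<mu> i) = on_obj (tcod \<mu>) i) \<and>
    (\<forall>f\<in>Mor I. on_mor (tcod \<mu>) f \<odot>\<^bsub>A\<^esub> tcmp \<mu> (dom1 I f) = tcmp \<mu> (cod1 I f) \<odot>\<^bsub>A\<^esub> on_mor (tdom \<mu>) f) \<and>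
    (\<forall>\<alpha>\<in>Cell I. on_cell (tcod \<mu>) \<alpha> \<star>\<^bsub>A\<^esub> id2 A (tcmp \<mu> (dom1 I (dom2 I \<alpha>))) =
       id2 A (tcmp \<mu> (cod1 I (dom2 I \<alpha>))) \<star>\<^bsub>A\<^esub> on_cell (tdom \<mu>) \<alpha>)"

definition modification ::
  "('o, 'm, 'c) two_cat \<Rightarrow> ('p, 'n, 'd) two_cat \<Rightarrow> ('o, 'm, 'c, 'p, 'n, 'd) modif \<Rightarrow> bool" where
  "modification I A \<phi> \<longleftrightarrow>
    two_natural I A (mdom \<phi>) \<and> two_natural I A (mcod \<phi>) \<and>
    tdom (mdom \<phi>) = tdom (mcod \<phi>) \<and> tcod (mdom \<phi>) = tcod (mcod \<phi>) \<and>
    mcmp \<phi> \<in> extensional (Obj I) \<and>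
    (\<forall>i\<in>Obj I. mcmp \<phi> i \<in> Cell A \<and>
       dom2 A (mcmp \<phi> i) = tcmp (mdom \<phi>) i \<and> cod2 A (mcmp \<phi> i) = tcmp (mcod \<phi>) i) \<and>
    (\<forall>f\<in>Mor I. id2 A (on_mor (tcod (mdom \<phi>)) f) \<star>\<^bsub>A\<^esub> mcmp \<phi> (dom1 I f) =
       mcmp \<phi> (cod1 I f) \<star>\<^bsub>A\<^esub> id2 A (on_mor (tdom (mdom \<phi>)) f))"

definition transf_comp ::
  "('o, 'm, 'c) two_cat \<Rightarrow> ('p, 'n, 'd) two_cat \<Rightarrow> ('o, 'm, 'c, 'p, 'n, 'd) transf \<Rightarrow>
    ('o, 'm, 'c, 'p, 'n, 'd) transf \<Rightarrow> ('o, 'm, 'c, 'p, 'n, 'd) transf" where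
  "transf_comp I A \<nu> \<mu> =
     \<lparr>tdom = tdom \<mu>, tcod = tcod \<nu>, tcmp = (\<lambda>i\<in>Obj I. tcmp \<nu> i \<odot>\<^bsub>A\<^esub> tcmp \<mu> i)\<rparr>"

definition two_fun_cat ::
  "('o, 'm, 'c) two_cat \<Rightarrow> ('p, 'n, 'd) two_cat \<Rightarrow>
    (('o, 'm, 'c, 'p, 'n, 'd) two_fun, ('o, 'm, 'c, 'p, 'n, 'd) transf,
     ('o, 'm, 'c, 'p, 'n, 'd) modif) two_cat" where
  "two_fun_cat I A = \<lparr>
     Obj = {F. two_functor I A F},
     Mor = {\<mu>. two_natural I A \<mu>},
     Cell = {\<phi>. modification I A \<phi>},
     dom1 = tdom, cod1 = tcod, dom2 = mdom, cod2 = mcod,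
     id1 = (\<lambda>F. \<lparr>tdom = F, tcod = F, tcmp = (\<lambda>i\<in>Obj I. id1 A (on_obj F i))\<rparr>),
     comp1 = transf_comp I A,
     id2 = (\<lambda>\<mu>. \<lparr>mdom = \<mu>, mcod = \<mu>, mcmp = (\<lambda>i\<in>Obj I. id2 A (tcmp \<mu> i))\<rparr>),
     vcomp = (\<lambda>\<psi> \<phi>. \<lparr>mdom = mdom \<phi>, mcod = mcod \<psi>, mcmp = (\<lambda>i\<in>Obj I. mcmp \<psi> i \<bullet>\<^bsub>A\<^esub> mcmp \<phi> i)\<rparr>),
     hcomp = (\<lambda>\<psi> \<phi>. \<lparr>mdom = transf_comp I A (mdom \<psi>) (mdom \<phi>), mcod = transf_comp I A (mcod \<psi>) (mcod \<phi>),
                mcmp = (\<lambda>i\<in>Obj I. mcmp \<psi> i \<star>\<^bsub>A\<^esub> mcmp \<phi> i)\<rparr>)\<rparr>"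


section \<open>2-cones, 2-limits and the pseudo-slice\<close>

definition diag_obj ::
  "('o, 'm, 'c) two_cat \<Rightarrow> ('p, 'n, 'd) two_cat \<Rightarrow> 'p \<Rightarrow> ('o, 'm, 'c, 'p, 'n, 'd) two_fun" where
  "diag_obj I A x = \<lparr>on_obj = (\<lambda>i\<in>Obj I. x), on_mor = (\<lambda>f\<in>Mor I. id1 A x),
     on_cell = (\<lambda>\<alpha>\<in>Cell I. id2 A (id1 A x))\<rparr>"

definition diag_mor ::
  "('o, 'm, 'c) two_cat \<Rightarrow> ('p, 'n, 'd) two_cat \<Rightarrow> 'n \<Rightarrow> ('o, 'm, 'c, 'p, 'n, 'd) transf" where
  "diag_mor I A f = \<lparr>tdom = diag_obj I A (dom1 A f), tcod = diag_obj I A (cod1 A f),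
     tcmp = (\<lambda>i\<in>Obj I. f)\<rparr>"

definition diag_cell ::
  "('o, 'm, 'c) two_cat \<Rightarrow> ('p, 'n, 'd) two_cat \<Rightarrow> 'd \<Rightarrow> ('o, 'm, 'c, 'p, 'n, 'd) modif" where
  "diag_cell I A \<alpha> = \<lparr>mdom = diag_mor I A (dom2 A \<alpha>), mcod = diag_mor I A (cod2 A \<alpha>),
     mcmp = (\<lambda>i\<in>Obj I. \<alpha>)\<rparr>"

definition two_cone ::
  "('o, 'm, 'c) two_cat \<Rightarrow> ('p, 'n, 'd) two_cat \<Rightarrow> ('o, 'm, 'c, 'p, 'n, 'd) two_fun \<Rightarrow>
    'p \<Rightarrow> ('o, 'm, 'c, 'p, 'n, 'd) transf \<Rightarrow> bool" where
  "two_cone I A F x \<mu> \<longleftrightarrow> x \<in> Obj A \<and> two_natural I A \<mu> \<and> tdom \<mu> = diag_obj I A x \<and> tcod \<mu> = F"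

definition two_limit ::
  "('o, 'm, 'c) two_cat \<Rightarrow> ('p, 'n, 'd) two_cat \<Rightarrow> ('o, 'm, 'c, 'p, 'n, 'd) two_fun \<Rightarrow>
    'p \<Rightarrow> ('o, 'm, 'c, 'p, 'n, 'd) transf \<Rightarrow> bool" where
  "two_limit I A F l lam \<longleftrightarrow> two_cone I A F l lam \<and>
    (\<forall>x\<in>Obj A. is_cat_iso (hom_cat A x l) (hom_cat (two_fun_cat I A) (diag_obj I A x) F)
       (\<lambda>f. lam \<odot>\<^bsub>two_fun_cat I A\<^esub> diag_mor I A f)
       (\<lambda>\<alpha>. id2 (two_fun_cat I A) lam \<star>\<^bsub>two_fun_cat I A\<^esub> diag_cell I A \<alpha>))"

text \<open>Morphisms and 2-morphisms of the pseudo-slice carry their source and target.\<close>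

type_synonym ('o, 'm, 'c, 'p, 'n, 'd) ps_obj = "'p \<times> ('o, 'm, 'c, 'p, 'n, 'd) transf"

record ('o, 'm, 'c, 'p, 'n, 'd) ps_mor =
  psdom :: "('o, 'm, 'c, 'p, 'n, 'd) ps_obj"
  pscod :: "('o, 'm, 'c, 'p, 'n, 'd) ps_obj"
  psmor :: 'n
  psmodif :: "('o, 'm, 'c, 'p, 'n, 'd) modif"

record ('o, 'm, 'c, 'p, 'n, 'd) ps_cell =
  pscdom :: "('o, 'm, 'c, 'p, 'n, 'd) ps_mor"
  psccod :: "('o, 'm, 'c, 'p, 'n, 'd) ps_mor"
  pscell :: 'd

definition pseudo_slice_mor ::
  "('o, 'm, 'c) two_cat \<Rightarrow> ('p, 'n, 'd) two_cat \<Rightarrow> ('o, 'm, 'c, 'p, 'n, 'd) two_fun \<Rightarrow>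
    ('o, 'm, 'c, 'p, 'n, 'd) ps_mor set" where
  "pseudo_slice_mor I A F = {u. \<exists>x \<mu> y \<nu> f \<phi>.
     u = \<lparr>psdom = (x, \<mu>), pscod = (y, \<nu>), psmor = f, psmodif = \<phi>\<rparr> \<and>
     two_cone I A F x \<mu> \<and> two_cone I A F y \<nu> \<and>
     f \<in> Mor A \<and> dom1 A f = x \<and> cod1 A f = y \<and>
     invertible_cell (two_fun_cat I A) \<phi> \<and>
     dom2 (two_fun_cat I A) \<phi> = \<nu> \<odot>\<^bsub>two_fun_cat I A\<^esub> diag_mor I A f \<and>
     cod2 (two_fun_cat I A) \<phi> = \<mu>}"

definition pseudo_slice_cell ::
  "('o, 'm, 'c) two_cat \<Rightarrow> ('p, 'n, 'd) two_cat \<Rightarrow> ('o, 'm, 'c, 'p, 'n, 'd) two_fun \<Rightarrow>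
    ('o, 'm, 'c, 'p, 'n, 'd) ps_cell set" where
  "pseudo_slice_cell I A F = {t. \<exists>u v \<alpha>.
     t = \<lparr>pscdom = u, psccod = v, pscell = \<alpha>\<rparr> \<and>
     u \<in> pseudo_slice_mor I A F \<and> v \<in> pseudo_slice_mor I A F \<and>
     psdom u = psdom v \<and> pscod u = pscod v \<and>
     \<alpha> \<in> Cell A \<and> dom2 A \<alpha> = psmor u \<and> cod2 A \<alpha> = psmor v \<and>
     psmodif v \<bullet>\<^bsub>two_fun_cat I A\<^esub>
       (id2 (two_fun_cat I A) (snd (pscod u)) \<star>\<^bsub>two_fun_cat I A\<^esub> diag_cell I A \<alpha>) = psmodif u}"

text \<open>For \<open>(f, \<phi>) : (X, \<mu>) \<rightarrow> (Y, \<nu>)\<close> and \<open>(g, \<psi>) : (Y, \<nu>) \<rightarrow> (Z, \<rho>)\<close>, the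
  composite is \<open>(g f, \<phi> (\<psi> * \<Delta> f))\<close>.\<close>

definition ps_comp ::
  "('o, 'm, 'c) two_cat \<Rightarrow> ('p, 'n, 'd) two_cat \<Rightarrow> ('o, 'm, 'c, 'p, 'n, 'd) ps_mor \<Rightarrow>
    ('o, 'm, 'c, 'p, 'n, 'd) ps_mor \<Rightarrow> ('o, 'm, 'c, 'p, 'n, 'd) ps_mor" where
  "ps_comp I A v u = \<lparr>psdom = psdom u, pscod = pscod v, psmor = psmor v \<odot>\<^bsub>A\<^esub> psmor u,
     psmodif = psmodif u \<bullet>\<^bsub>two_fun_cat I A\<^esub>
       (psmodif v \<star>\<^bsub>two_fun_cat I A\<^esub> id2 (two_fun_cat I A) (diag_mor I A (psmor u)))\<rparr>"

definition pseudo_slice ::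
  "('o, 'm, 'c) two_cat \<Rightarrow> ('p, 'n, 'd) two_cat \<Rightarrow> ('o, 'm, 'c, 'p, 'n, 'd) two_fun \<Rightarrow>
    (('o, 'm, 'c, 'p, 'n, 'd) ps_obj, ('o, 'm, 'c, 'p, 'n, 'd) ps_mor,
     ('o, 'm, 'c, 'p, 'n, 'd) ps_cell) two_cat" where
  "pseudo_slice I A F = \<lparr>
     Obj = {(x, \<mu>). two_cone I A F x \<mu>},
     Mor = pseudo_slice_mor I A F,
     Cell = pseudo_slice_cell I A F,
     dom1 = psdom, cod1 = pscod, dom2 = pscdom, cod2 = psccod,
     id1 = (\<lambda>(x, \<mu>). \<lparr>psdom = (x, \<mu>), pscod = (x, \<mu>), psmor = id1 A x,
              psmodif = id2 (two_fun_cat I A) \<mu>\<rparr>),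
     comp1 = ps_comp I A,
     id2 = (\<lambda>u. \<lparr>pscdom = u, psccod = u, pscell = id2 A (psmor u)\<rparr>),
     vcomp = (\<lambda>t s. \<lparr>pscdom = pscdom s, psccod = psccod t, pscell = pscell t \<bullet>\<^bsub>A\<^esub> pscell s\<rparr>),
     hcomp = (\<lambda>t s. \<lparr>pscdom = ps_comp I A (pscdom t) (pscdom s),
                psccod = ps_comp I A (psccod t) (psccod s), pscell = pscell t \<star>\<^bsub>A\<^esub> pscell s\<rparr>)\<rparr>"


section \<open>2-categories given by generators and relations\<close>

text \<open>Morphisms are well-typed terms in the generating morphisms, modulo the least congruence
  containing the category axioms and the relations; 2-morphisms are well-typed terms in the
  generating 2-morphisms and the formal inverses, modulo the least congruence containing the
  2-category axioms, the inverse laws and the relations.\<close>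

datatype ('o, 'g) mterm = MId 'o | MGen 'g | MComp "('o, 'g) mterm" "('o, 'g) mterm"

datatype ('o, 'g, 'h) cterm = CId "('o, 'g) mterm" | CGen 'h | CInv 'h
  | VComp "('o, 'g, 'h) cterm" "('o, 'g, 'h) cterm"
  | HComp "('o, 'g, 'h) cterm" "('o, 'g, 'h) cterm"

record ('o, 'g, 'h) presentation =
  gen_obj :: "'o set"
  gen_mor :: "'g set"
  gen_dom :: "'g \<Rightarrow> 'o"
  gen_cod :: "'g \<Rightarrow> 'o"
  rel_mor :: "(('o, 'g) mterm \<times> ('o, 'g) mterm) set"
  gen_cell :: "'h set"
  gen_src :: "'h \<Rightarrow> ('o, 'g) mterm"
  gen_tgt :: "'h \<Rightarrow> ('o, 'g) mterm"
  gen_inv :: "'h set"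
  rel_cell :: "(('o, 'g, 'h) cterm \<times> ('o, 'g, 'h) cterm) set"

inductive mtyp :: "('o, 'g, 'h) presentation \<Rightarrow> ('o, 'g) mterm \<Rightarrow> 'o \<Rightarrow> 'o \<Rightarrow> bool"
  for P where
  mtyp_id: "x \<in> gen_obj P \<Longrightarrow> mtyp P (MId x) x x"
| mtyp_gen: "g \<in> gen_mor P \<Longrightarrow> gen_dom P g \<in> gen_obj P \<Longrightarrow> gen_cod P g \<in> gen_obj P \<Longrightarrow>
    mtyp P (MGen g) (gen_dom P g) (gen_cod P g)"
| mtyp_comp: "mtyp P s y z \<Longrightarrow> mtyp P t x y \<Longrightarrow> mtyp P (MComp s t) x z"

inductive meq :: "('o, 'g, 'h) presentation \<Rightarrow> ('o, 'g) mterm \<Rightarrow> ('o, 'g) mterm \<Rightarrow> bool"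
  for P where
  meq_refl: "mtyp P t x y \<Longrightarrow> meq P t t"
| meq_sym: "meq P s t \<Longrightarrow> meq P t s"
| meq_trans: "meq P r s \<Longrightarrow> meq P s t \<Longrightarrow> meq P r t"
| meq_cong: "meq P s s' \<Longrightarrow> meq P t t' \<Longrightarrow> mtyp P (MComp s t) x z \<Longrightarrow>
    meq P (MComp s t) (MComp s' t')"
| meq_unit_left: "mtyp P t x y \<Longrightarrow> meq P (MComp (MId y) t) t"
| meq_unit_right: "mtyp P t x y \<Longrightarrow> meq P (MComp t (MId x)) t"
| meq_assoc: "mtyp P (MComp (MComp r s) t) x y \<Longrightarrow>
    meq P (MComp (MComp r s) t) (MComp r (MComp s t))"
| meq_rel: "(s, t) \<in> rel_mor P \<Longrightarrow> mtyp P s x y \<Longrightarrow> mtyp P t x y \<Longrightarrow> meq P s t"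

inductive ctyp ::
  "('o, 'g, 'h) presentation \<Rightarrow> ('o, 'g, 'h) cterm \<Rightarrow> ('o, 'g) mterm \<Rightarrow> ('o, 'g) mterm \<Rightarrow> bool"
  for P where
  ctyp_id: "mtyp P u x y \<Longrightarrow> ctyp P (CId u) u u"
| ctyp_gen: "h \<in> gen_cell P \<Longrightarrow> mtyp P (gen_src P h) x y \<Longrightarrow> mtyp P (gen_tgt P h) x y \<Longrightarrow>
    ctyp P (CGen h) (gen_src P h) (gen_tgt P h)"
| ctyp_inv: "h \<in> gen_cell P \<Longrightarrow> h \<in> gen_inv P \<Longrightarrow> mtyp P (gen_src P h) x y \<Longrightarrow>
    mtyp P (gen_tgt P h) x y \<Longrightarrow> ctyp P (CInv h) (gen_tgt P h) (gen_src P h)"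
| ctyp_vcomp: "ctyp P s v w \<Longrightarrow> ctyp P t u v \<Longrightarrow> ctyp P (VComp s t) u w"
| ctyp_hcomp: "ctyp P s u u' \<Longrightarrow> ctyp P t v v' \<Longrightarrow> mtyp P (MComp u v) x z \<Longrightarrow>
    ctyp P (HComp s t) (MComp u v) (MComp u' v')"
| ctyp_conv: "ctyp P t u v \<Longrightarrow> meq P u u' \<Longrightarrow> meq P v v' \<Longrightarrow> ctyp P t u' v'"

inductive ceq ::
  "('o, 'g, 'h) presentation \<Rightarrow> ('o, 'g, 'h) cterm \<Rightarrow> ('o, 'g, 'h) cterm \<Rightarrow> bool"
  for P where
  ceq_refl: "ctyp P t u v \<Longrightarrow> ceq P t t"
| ceq_sym: "ceq P s t \<Longrightarrow> ceq P t s"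
| ceq_trans: "ceq P r s \<Longrightarrow> ceq P s t \<Longrightarrow> ceq P r t"
| ceq_id_cong: "meq P u v \<Longrightarrow> ceq P (CId u) (CId v)"
| ceq_vcong: "ceq P s s' \<Longrightarrow> ceq P t t' \<Longrightarrow> ctyp P (VComp s t) u v \<Longrightarrow>
    ceq P (VComp s t) (VComp s' t')"
| ceq_hcong: "ceq P s s' \<Longrightarrow> ceq P t t' \<Longrightarrow> ctyp P (HComp s t) u v \<Longrightarrow>
    ceq P (HComp s t) (HComp s' t')"
| ceq_vunit_left: "ctyp P t u v \<Longrightarrow> ceq P (VComp (CId v) t) t"
| ceq_vunit_right: "ctyp P t u v \<Longrightarrow> ceq P (VComp t (CId u)) t"
| ceq_vassoc: "ctyp P (VComp (VComp r s) t) u v \<Longrightarrow>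
    ceq P (VComp (VComp r s) t) (VComp r (VComp s t))"
| ceq_hunit_left: "ctyp P t u v \<Longrightarrow> mtyp P u x y \<Longrightarrow> ceq P (HComp (CId (MId y)) t) t"
| ceq_hunit_right: "ctyp P t u v \<Longrightarrow> mtyp P u x y \<Longrightarrow> ceq P (HComp t (CId (MId x))) t"
| ceq_hassoc: "ctyp P (HComp (HComp r s) t) u v \<Longrightarrow>
    ceq P (HComp (HComp r s) t) (HComp r (HComp s t))"
| ceq_hid: "mtyp P (MComp u v) x y \<Longrightarrow> ceq P (HComp (CId u) (CId v)) (CId (MComp u v))"
| ceq_interchange: "ctyp P (HComp (VComp s' s) (VComp t' t)) u v \<Longrightarrow>
    ceq P (HComp (VComp s' s) (VComp t' t)) (VComp (HComp s' t') (HComp s t))"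
| ceq_inv_left: "ctyp P (CInv h) u v \<Longrightarrow> ceq P (VComp (CInv h) (CGen h)) (CId (gen_src P h))"
| ceq_inv_right: "ctyp P (CInv h) u v \<Longrightarrow> ceq P (VComp (CGen h) (CInv h)) (CId (gen_tgt P h))"
| ceq_rel: "(s, t) \<in> rel_cell P \<Longrightarrow> ctyp P s u v \<Longrightarrow> ctyp P t u v \<Longrightarrow> ceq P s t"

definition mclass :: "('o, 'g, 'h) presentation \<Rightarrow> ('o, 'g) mterm \<Rightarrow> ('o, 'g) mterm set" where
  "mclass P t = {s. meq P s t}"

definition cclass :: "('o, 'g, 'h) presentation \<Rightarrow> ('o, 'g, 'h) cterm \<Rightarrow> ('o, 'g, 'h) cterm set" where
  "cclass P t = {s. ceq P s t}"

definition presented ::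
  "('o, 'g, 'h) presentation \<Rightarrow> ('o, ('o, 'g) mterm set, ('o, 'g, 'h) cterm set) two_cat" where
  "presented P = \<lparr>
     Obj = gen_obj P,
     Mor = {mclass P t | t. \<exists>x y. mtyp P t x y},
     Cell = {cclass P t | t. \<exists>u v. ctyp P t u v},
     dom1 = (\<lambda>M. THE x. \<exists>t\<in>M. \<exists>y. mtyp P t x y),
     cod1 = (\<lambda>M. THE y. \<exists>t\<in>M. \<exists>x. mtyp P t x y),
     dom2 = (\<lambda>K. {u. \<exists>t\<in>K. \<exists>v. ctyp P t u v}),
     cod2 = (\<lambda>K. {v. \<exists>t\<in>K. \<exists>u. ctyp P t u v}),
     id1 = (\<lambda>x. mclass P (MId x)),
     comp1 = (\<lambda>M N. {r. \<exists>s\<in>M. \<exists>t\<in>N. meq P r (MComp s t)}),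
     id2 = (\<lambda>M. {r. \<exists>u\<in>M. ceq P r (CId u)}),
     vcomp = (\<lambda>K L. {r. \<exists>s\<in>K. \<exists>t\<in>L. ceq P r (VComp s t)}),
     hcomp = (\<lambda>K L. {r. \<exists>s\<in>K. \<exists>t\<in>L. ceq P r (HComp s t)})\<rparr>"


inductive_cases mtyp_idE: "mtyp P (MId a) x y"
inductive_cases mtyp_genE: "mtyp P (MGen a) x y"
inductive_cases mtyp_compE: "mtyp P (MComp s t) x y"

lemma mtyp_unique: "mtyp P t x y \<Longrightarrow> mtyp P t x' y' \<Longrightarrow> x = x' \<and> y = y'"
proof (induction t arbitrary: x y x' y')
  case (MComp s t)
  from MComp.prems(1) obtain z where "mtyp P s z y" "mtyp P t x z" by (rule mtyp_compE)
  moreover from MComp.prems(2) obtain z' where "mtyp P s z' y'" "mtyp P t x' z'" by (rule mtyp_compE)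
  ultimately show ?case using MComp.IH by blast
qed (auto elim!: mtyp_idE mtyp_genE)

lemma mtyp_obj: "mtyp P t x y \<Longrightarrow> x \<in> gen_obj P \<and> y \<in> gen_obj P"
  by (induction rule: mtyp.induct) auto

lemma meq_typ: "meq P s t \<Longrightarrow> \<exists>x y. mtyp P s x y \<and> mtyp P t x y"
proof (induction rule: meq.induct)
  case (meq_trans r s t) then show ?case by (metis mtyp_unique)
next
  case (meq_cong s s' t t' x z)
  from meq_cong(3) obtain y where "mtyp P s y z" "mtyp P t x y" by (auto elim: mtyp_compE)
  with meq_cong(4,5) have "mtyp P s' y z" "mtyp P t' x y" by (metis mtyp_unique)+
  with meq_cong(3) show ?case by (blast intro: mtyp_comp)
next
  case (meq_unit_left t x y) then show ?case by (meson mtyp.intros mtyp_obj)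
next
  case (meq_unit_right t x y) then show ?case by (meson mtyp.intros mtyp_obj)
next
  case (meq_assoc r s t x y) then show ?case by (blast elim: mtyp_compE intro: mtyp_comp)
qed blast+

lemma meq_mtyp: "meq P s t \<Longrightarrow> mtyp P s x y \<Longrightarrow> mtyp P t x y"
  by (metis meq_typ mtyp_unique)
lemma meq_mtyp': "meq P s t \<Longrightarrow> mtyp P t x y \<Longrightarrow> mtyp P s x y"
  by (metis meq_typ mtyp_unique)

lemma ctyp_par: "ctyp P t u v \<Longrightarrow> \<exists>x y. mtyp P u x y \<and> mtyp P v x y"
proof (induction rule: ctyp.induct)
  case (ctyp_vcomp s v w t u) then show ?case by (metis mtyp_unique)
next
  case (ctyp_hcomp s u u' t v v' x z)
  from ctyp_hcomp(3) obtain y where "mtyp P u y z" "mtyp P v x y" by (auto elim: mtyp_compE)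
  with ctyp_hcomp(4,5) have "mtyp P u' y z" "mtyp P v' x y" by (metis mtyp_unique)+
  with ctyp_hcomp(3) show ?case by (blast intro: mtyp_comp)
next
  case (ctyp_conv t u v u' v') then show ?case by (meson meq_mtyp)
qed blast+

lemma ctyp_idD: "ctyp P t u v \<Longrightarrow> t = CId w \<Longrightarrow> meq P w u \<and> meq P w v"
  proof (induction rule: ctyp.induct)
  case (ctyp_conv t u v u' v') then show ?case by (metis meq_trans)
qed (auto intro: meq_refl)
lemma ctyp_genD: "ctyp P t u v \<Longrightarrow> t = CGen h \<Longrightarrow> h \<in> gen_cell P \<and> meq P (gen_src P h) u \<and> meq P (gen_tgt P h) v"
  proof (induction rule: ctyp.induct)
  case (ctyp_conv t u v u' v') then show ?case by (metis meq_trans)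
qed (auto intro: meq_refl)
lemma ctyp_invD: "ctyp P t u v \<Longrightarrow> t = CInv h \<Longrightarrow> h \<in> gen_cell P \<and> h \<in> gen_inv P \<and> meq P (gen_tgt P h) u \<and> meq P (gen_src P h) v"
  proof (induction rule: ctyp.induct)
  case (ctyp_conv t u v u' v') then show ?case by (metis meq_trans)
qed (auto intro: meq_refl)
lemma ctyp_refl: "ctyp P t u v \<Longrightarrow> meq P u u \<and> meq P v v"
  by (meson ctyp_par meq_refl)
lemma ctyp_vcompD: "ctyp P t u w \<Longrightarrow> t = VComp r s \<Longrightarrow> \<exists>v. ctyp P r v w \<and> ctyp P s u v"
proof (induction rule: ctyp.induct)
  case (ctyp_conv t u v u' v') then show ?case by (metis ctyp.ctyp_conv ctyp_refl)
qed auto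
lemma ctyp_hcompD: "ctyp P t p q \<Longrightarrow> t = HComp r s \<Longrightarrow> \<exists>u u' v v' x z. ctyp P r u u' \<and> ctyp P s v v' \<and>
   mtyp P (MComp u v) x z \<and> meq P (MComp u v) p \<and> meq P (MComp u' v') q"
proof (induction rule: ctyp.induct)
  case (ctyp_hcomp s u u' t v v' x z)
  then have "ctyp P (HComp s t) (MComp u v) (MComp u' v')" by (blast intro: ctyp.intros)
  with ctyp_hcomp show ?case by (blast dest: ctyp_refl)
next
  case (ctyp_conv t u v u' v') then show ?case by (meson meq_trans)
qed auto

lemma ctyp_unique: "ctyp P t u v \<Longrightarrow> ctyp P t u' v' \<Longrightarrow> meq P u u' \<and> meq P v v'"
proof (induction arbitrary: u' v' rule: ctyp.induct)
  case (ctyp_vcomp s v w t u) then show ?case using ctyp_vcompD[OF ctyp_vcomp.prems refl] by blast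
next
  case (ctyp_hcomp s u u1 t v v1 x z)
  from ctyp_hcompD[OF ctyp_hcomp.prems refl] obtain a a' b b' where
    *: "ctyp P s a a'" "ctyp P t b b'" "meq P (MComp a b) u'" "meq P (MComp a' b') v'" by blast
  have 1: "meq P u a" "meq P u1 a'" "meq P v b" "meq P v1 b'" using ctyp_hcomp.IH * by blast+
  have 2: "ctyp P (HComp s t) (MComp u v) (MComp u1 v1)" using ctyp_hcomp by (blast intro: ctyp.intros)
  have "\<exists>x y. mtyp P (MComp u1 v1) x y" using ctyp_par[OF 2] by blast
  then show ?case using 1 * ctyp_hcomp(3) by (meson meq_cong meq_trans)
next
  case (ctyp_conv t u v u1 v1) then show ?case by (meson meq_sym meq_trans)
next
  case (ctyp_id u x y) then show ?case using ctyp_idD[OF ctyp_id.prems refl] by simp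
next
  case (ctyp_gen h x y) then show ?case using ctyp_genD[OF ctyp_gen.prems refl] by simp
next
  case (ctyp_inv h x y) then show ?case using ctyp_invD[OF ctyp_inv.prems refl] by simp
qed

lemma ctyp_hcompI: assumes "ctyp P s u u'" "ctyp P t v v'" "mtyp P u y z" "mtyp P v x y"
  shows "ctyp P (HComp s t) (MComp u v) (MComp u' v')"
  using assms by (meson ctyp_hcomp mtyp_comp)

lemma ctyp_hcompE: assumes "ctyp P (HComp r s) p q"
  obtains u u' v v' x y z where "ctyp P r u u'" "ctyp P s v v'"
   "mtyp P u y z" "mtyp P v x y" "mtyp P u' y z" "mtyp P v' x y" "meq P (MComp u v) p" "meq P (MComp u' v') q"
proof -
  from ctyp_hcompD[OF assms refl] obtain u u' v v' x z where
   *: "ctyp P r u u'" "ctyp P s v v'" "mtyp P (MComp u v) x z" "meq P (MComp u v) p" "meq P (MComp u' v') q" by blast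
  from *(3) obtain y where "mtyp P u y z" "mtyp P v x y" by (auto elim: mtyp_compE)
  moreover have "mtyp P u' y z" "mtyp P v' x y" using calculation * by (metis ctyp_par mtyp_unique)+
  ultimately show ?thesis using * that by blast
qed

lemma ceq_typ: "ceq P s t \<Longrightarrow> \<exists>u v. ctyp P s u v \<and> ctyp P t u v"
proof (induction rule: ceq.induct)
  case (ceq_trans r s t)
  then obtain u v u' v' where "ctyp P r u v" "ctyp P s u v" "ctyp P s u' v'" "ctyp P t u' v'" by blast
  then show ?case by (meson ctyp_conv ctyp_unique)
next
  case (ceq_id_cong u v)
  then obtain x y where "mtyp P u x y" "mtyp P v x y" using meq_typ by blast
  with ceq_id_cong show ?case by (meson ctyp_id ctyp_conv meq_sym)
next
  case (ceq_vcong s s' t t' u w)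
  from ctyp_vcompD[OF ceq_vcong(3) refl] obtain v where v: "ctyp P s v w" "ctyp P t u v" by blast
  have "ctyp P s' v w" "ctyp P t' u v" using v ceq_vcong by (meson ctyp_conv ctyp_unique)+
  then show ?case using ceq_vcong(3) ctyp_vcomp by blast
next
  case (ceq_hcong s s' t t' p q)
  from ceq_hcong(3) obtain u u' v v' x y z where v: "ctyp P s u u'" "ctyp P t v v'"
   "mtyp P u y z" "mtyp P v x y" "meq P (MComp u v) p" "meq P (MComp u' v') q" by (rule ctyp_hcompE)
  have "ctyp P s' u u'" "ctyp P t' v v'" using v ceq_hcong by (meson ctyp_conv ctyp_unique)+
  then show ?case using v ceq_hcong(3) ctyp_conv ctyp_hcompI by meson
next
  case (ceq_vunit_left t u v) then show ?case by (meson ctyp_id ctyp_vcomp ctyp_par)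
next
  case (ceq_vunit_right t u v) then show ?case by (meson ctyp_id ctyp_vcomp ctyp_par)
next
  case (ceq_vassoc r s t u v)
  from ctyp_vcompD[OF this refl] obtain w where w: "ctyp P (VComp r s) w v" "ctyp P t u w" by blast
  from ctyp_vcompD[OF w(1) refl] w ceq_vassoc show ?case by (blast intro: ctyp_vcomp)
next
  case (ceq_hunit_left t u v x y)
  have v: "mtyp P v x y" using ceq_hunit_left by (metis ctyp_par mtyp_unique)
  have i: "mtyp P (MId y) y y" using ceq_hunit_left by (meson mtyp_id mtyp_obj)
  have "ctyp P (HComp (CId (MId y)) t) (MComp (MId y) u) (MComp (MId y) v)"
    using ctyp_hcompI ctyp_id i ceq_hunit_left by meson
  then have "ctyp P (HComp (CId (MId y)) t) u v" using v ceq_hunit_left by (meson ctyp_conv meq_unit_left)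
  then show ?case using ceq_hunit_left by blast
next
  case (ceq_hunit_right t u v x y)
  have v: "mtyp P v x y" using ceq_hunit_right by (metis ctyp_par mtyp_unique)
  have i: "mtyp P (MId x) x x" using ceq_hunit_right by (meson mtyp_id mtyp_obj)
  have "ctyp P (HComp t (CId (MId x))) (MComp u (MId x)) (MComp v (MId x))"
    using ctyp_hcompI ctyp_id i ceq_hunit_right by meson
  then have "ctyp P (HComp t (CId (MId x))) u v" using v ceq_hunit_right by (meson ctyp_conv meq_unit_right)
  then show ?case using ceq_hunit_right by blast
next
  case (ceq_hassoc r s t p q)
  from ceq_hassoc obtain m m' w w' a b d where 1: "ctyp P (HComp r s) m m'" "ctyp P t w w'"
   "mtyp P m b d" "mtyp P w a b" "mtyp P w' a b" "meq P (MComp m w) p" "meq P (MComp m' w') q" by (rule ctyp_hcompE)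
  from 1(1) obtain u u' v v' y z x where 2: "ctyp P r u u'" "ctyp P s v v'"
   "mtyp P u y z" "mtyp P v x y" "mtyp P u' y z" "mtyp P v' x y" "meq P (MComp u v) m" "meq P (MComp u' v') m'" by (rule ctyp_hcompE)
  have xb: "x = b" "z = d" using 1(3) 2 by (meson meq_mtyp mtyp_comp mtyp_unique)+
  have 3: "ctyp P (HComp r (HComp s t)) (MComp u (MComp v w)) (MComp u' (MComp v' w'))"
    using 1 2 xb by (meson ctyp_hcompI mtyp_comp)
  have "meq P (MComp u (MComp v w)) (MComp (MComp u v) w)" "meq P (MComp u' (MComp v' w')) (MComp (MComp u' v') w')"
    using 1 2 xb by (meson meq_assoc meq_sym mtyp_comp)+
  moreover have "meq P (MComp (MComp u v) w) (MComp m w)" "meq P (MComp (MComp u' v') w') (MComp m' w')"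
    using 1 2 xb by (meson meq_cong meq_refl mtyp_comp)+
  ultimately have "meq P (MComp u (MComp v w)) p" "meq P (MComp u' (MComp v' w')) q" using 1 by (meson meq_trans)+
  then show ?case using 3 ceq_hassoc ctyp_conv by blast
next
  case (ceq_hid u v x y) 
  then obtain w where "mtyp P u w y" "mtyp P v x w" by (auto elim: mtyp_compE)
  then show ?case using ceq_hid by (meson ctyp_hcomp ctyp_id)
next
  case (ceq_interchange s' s t' t p q)
  from ceq_interchange obtain u u' v v' y z x where 2: "ctyp P (VComp s' s) u u'" "ctyp P (VComp t' t) v v'"
   "mtyp P u y z" "mtyp P v x y" "mtyp P u' y z" "mtyp P v' x y" "meq P (MComp u v) p" "meq P (MComp u' v') q" by (rule ctyp_hcompE)
  from ctyp_vcompD[OF 2(1) refl] ctyp_vcompD[OF 2(2) refl] obtain m n where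
    3: "ctyp P s' m u'" "ctyp P s u m" "ctyp P t' n v'" "ctyp P t v n" by blast
  then have "mtyp P m y z" "mtyp P n x y" using 2 by (metis ctyp_par mtyp_unique)+
  then have "ctyp P (VComp (HComp s' t') (HComp s t)) (MComp u v) (MComp u' v')"
    using 2 3 by (meson ctyp_hcompI ctyp_vcomp)
  then show ?case using 2 ceq_interchange ctyp_conv by blast
next
  case (ceq_inv_left h u v)
  from ctyp_invD[OF this refl] obtain x y where *: "h \<in> gen_cell P" "h \<in> gen_inv P" "mtyp P (gen_src P h) x y" "mtyp P (gen_tgt P h) x y"
    by (metis ceq_inv_left ctyp_par meq_mtyp')
  then show ?case by (meson ctyp_gen ctyp_inv ctyp_id ctyp_vcomp)
next
  case (ceq_inv_right h u v)
  from ctyp_invD[OF this refl] obtain x y where *: "h \<in> gen_cell P" "h \<in> gen_inv P" "mtyp P (gen_src P h) x y" "mtyp P (gen_tgt P h) x y"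
    by (metis ceq_inv_right ctyp_par meq_mtyp')
  then show ?case by (meson ctyp_gen ctyp_inv ctyp_id ctyp_vcomp)
qed blast+

lemma ceq_ctyp: "ceq P s t \<Longrightarrow> ctyp P s u v \<Longrightarrow> ctyp P t u v"
  by (meson ceq_typ ctyp_conv ctyp_unique)

context
  fixes P :: "('o, 'g, 'h) presentation"
begin

lemma mclass_eq: "meq P s t \<Longrightarrow> mclass P s = mclass P t"
  unfolding mclass_def by (blast intro: meq_trans meq_sym)
lemma mclass_eqD: "mclass P s = mclass P t \<Longrightarrow> mtyp P s x y \<Longrightarrow> meq P s t"
  unfolding mclass_def by (blast intro: meq_refl)
lemma cclass_eq: "ceq P s t \<Longrightarrow> cclass P s = cclass P t"
  unfolding cclass_def by (blast intro: ceq_trans ceq_sym)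
lemma cclass_eqD: "cclass P s = cclass P t \<Longrightarrow> ctyp P s x y \<Longrightarrow> ceq P s t"
  unfolding cclass_def by (blast intro: ceq_refl)


lemma presented_dom1: assumes "mtyp P t x y" shows "dom1 (presented P) (mclass P t) = x" "cod1 (presented P) (mclass P t) = y"
proof -
  have *: "s \<in> mclass P t \<Longrightarrow> mtyp P s x y" for s unfolding mclass_def using assms meq_mtyp' by fastforce
  have t: "t \<in> mclass P t" using assms unfolding mclass_def by (auto intro: meq_refl)
  show "dom1 (presented P) (mclass P t) = x" unfolding presented_def two_cat.simps
    by (rule the_equality, use t assms in blast, metis * assms mtyp_unique)
  show "cod1 (presented P) (mclass P t) = y" unfolding presented_def two_cat.simps
    by (rule the_equality, use t assms in blast, metis * assms mtyp_unique)
qed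

lemma presented_dom2: assumes "ctyp P t u v" shows "dom2 (presented P) (cclass P t) = mclass P u" "cod2 (presented P) (cclass P t) = mclass P v"
proof -
  have *: "s \<in> cclass P t \<Longrightarrow> ctyp P s u v" for s unfolding cclass_def using assms ceq_ctyp ceq_sym by fast
  have t: "t \<in> cclass P t" using assms unfolding cclass_def by (auto intro: ceq_refl)
  have m: "meq P u u" "meq P v v" using assms ctyp_refl by blast+
  show "dom2 (presented P) (cclass P t) = mclass P u" unfolding presented_def two_cat.simps mclass_def
    using * t m by (auto dest: ctyp_unique intro: meq_sym ctyp_conv)
  show "cod2 (presented P) (cclass P t) = mclass P v" unfolding presented_def two_cat.simps mclass_def
    using * t m by (auto dest: ctyp_unique intro: meq_sym ctyp_conv)
qed

lemma presented_comp1: assumes "mtyp P s y z" "mtyp P t x y"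
  shows "comp1 (presented P) (mclass P s) (mclass P t) = mclass P (MComp s t)"
proof -
  have "meq P r (MComp s t)" if "meq P s' s" "meq P t' t" "meq P r (MComp s' t')" for s' t' r
    using that assms by (meson meq_cong meq_mtyp' mtyp_comp meq_trans)
  moreover have "meq P s s" "meq P t t" using assms by (auto intro: meq_refl)
  ultimately show ?thesis unfolding presented_def two_cat.simps mclass_def by blast
qed

lemma presented_vcomp: assumes "ctyp P s v w" "ctyp P t u v"
  shows "vcomp (presented P) (cclass P s) (cclass P t) = cclass P (VComp s t)"
proof -
  have "ceq P r (VComp s t)" if "ceq P s' s" "ceq P t' t" "ceq P r (VComp s' t')" for s' t' r
    using that assms by (meson ceq_vcong ceq_ctyp ceq_sym ctyp_vcomp ceq_trans)
  moreover have "ceq P s s" "ceq P t t" using assms by (auto intro: ceq_refl)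
  ultimately show ?thesis unfolding presented_def two_cat.simps cclass_def by blast
qed

lemma presented_hcomp: assumes "ctyp P s u u'" "ctyp P t v v'" "mtyp P u y z" "mtyp P v x y"
  shows "hcomp (presented P) (cclass P s) (cclass P t) = cclass P (HComp s t)"
proof -
  have "ceq P r (HComp s t)" if "ceq P s' s" "ceq P t' t" "ceq P r (HComp s' t')" for s' t' r
    using that assms by (meson ceq_hcong ceq_ctyp ceq_sym ctyp_hcompI ceq_trans)
  moreover have "ceq P s s" "ceq P t t" using assms by (auto intro: ceq_refl)
  ultimately show ?thesis unfolding presented_def two_cat.simps cclass_def by blast
qed

lemma presented_id2: assumes "mtyp P u x y" shows "id2 (presented P) (mclass P u) = cclass P (CId u)"
proof -
  have "ceq P r (CId u)" if "meq P u' u" "ceq P r (CId u')" for u' r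
    using that by (meson ceq_id_cong ceq_trans)
  moreover have "meq P u u" using assms by (auto intro: meq_refl)
  ultimately show ?thesis unfolding presented_def two_cat.simps mclass_def cclass_def by blast
qed

lemma presented_id1: "id1 (presented P) x = mclass P (MId x)" by (simp add: presented_def)
lemma presented_Obj: "Obj (presented P) = gen_obj P" by (simp add: presented_def)
lemma presented_MorI: "mtyp P t x y \<Longrightarrow> mclass P t \<in> Mor (presented P)" by (auto simp: presented_def)
lemma presented_CellI: "ctyp P t u v \<Longrightarrow> cclass P t \<in> Cell (presented P)" by (auto simp: presented_def)
lemma presented_MorE: assumes "f \<in> Mor (presented P)" obtains t where "f = mclass P t" "mtyp P t (dom1 (presented P) f) (cod1 (presented P) f)"
  using assms presented_dom1 by (fastforce simp: presented_def)
lemma presented_CellE: assumes "\<alpha> \<in> Cell (presented P)" obtains t u v where "\<alpha> = cclass P t" "ctyp P t u v" "dom2 (presented P) \<alpha> = mclass P u"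
    "cod2 (presented P) \<alpha> = mclass P v" "mtyp P u (dom1 (presented P) (dom2 (presented P) \<alpha>)) (cod1 (presented P) (dom2 (presented P) \<alpha>))" "mtyp P v (dom1 (presented P) (dom2 (presented P) \<alpha>)) (cod1 (presented P) (dom2 (presented P) \<alpha>))"
proof -
  from assms obtain t u v where *: "\<alpha> = cclass P t" "ctyp P t u v" by (auto simp: presented_def)
  then obtain x y where "mtyp P u x y" "mtyp P v x y" using ctyp_par by blast
  with * show ?thesis by (intro that[of t u v]) (simp_all add: presented_dom1 presented_dom2)
qed

lemma presented_comp1': assumes "mtyp P s y z" "mtyp P t x y"
  shows "comp1 (presented P) (mclass P s) (mclass P t) = mclass P (MComp s t) \<and> mclass P (MComp s t) \<in> Mor (presented P) \<and> dom1 (presented P) (mclass P (MComp s t)) = x \<and> cod1 (presented P) (mclass P (MComp s t)) = z"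
  using presented_comp1[OF assms] presented_dom1[OF mtyp_comp[OF assms]] presented_MorI[OF mtyp_comp[OF assms]] by simp
lemma presented_MorE': assumes "f \<in> Mor (presented P)" obtains t x y where "f = mclass P t" "mtyp P t x y" "dom1 (presented P) f = x" "cod1 (presented P) f = y"
  using assms presented_MorE by metis

lemma ctyp_class_conv: "ctyp P s v' w \<Longrightarrow> mclass P v' = mclass P v \<Longrightarrow> ctyp P s v w"
  by (meson ctyp_par mclass_eqD ctyp_conv ctyp_refl)

lemma presented_two_category: "two_category (presented P)"
proof
  fix f assume "f \<in> Mor (presented P)" then show "dom1 (presented P) f \<in> Obj (presented P) \<and> cod1 (presented P) f \<in> Obj (presented P)"
    by (metis presented_MorE mtyp_obj presented_Obj)
next
  fix a assume "a \<in> Cell (presented P)" then show "dom2 (presented P) a \<in> Mor (presented P) \<and> cod2 (presented P) a \<in> Mor (presented P) \<and>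
      dom1 (presented P) (dom2 (presented P) a) = dom1 (presented P) (cod2 (presented P) a) \<and> cod1 (presented P) (dom2 (presented P) a) = cod1 (presented P) (cod2 (presented P) a)"
  proof (rule presented_CellE)
    fix t u v assume t: "a = cclass P t" "ctyp P t u v" "dom2 (presented P) a = mclass P u" "cod2 (presented P) a = mclass P v"
    obtain x y where "mtyp P u x y" "mtyp P v x y" using ctyp_par[OF t(2)] by blast
    then show ?thesis unfolding t(3,4) using presented_dom1 presented_MorI by simp
  qed
next
  fix x assume "x \<in> Obj (presented P)" then have "mtyp P (MId x) x x" by (simp add: mtyp_id presented_Obj)
  then show "id1 (presented P) x \<in> Mor (presented P) \<and> dom1 (presented P) (id1 (presented P) x) = x \<and> cod1 (presented P) (id1 (presented P) x) = x" 
    unfolding presented_id1 using presented_MorI presented_dom1 by metis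
next
  fix g f assume *: "g \<in> Mor (presented P)" "f \<in> Mor (presented P)" "dom1 (presented P) g = cod1 (presented P) f"
  from *(1) obtain s y z where s: "g = mclass P s" "mtyp P s y z" "dom1 (presented P) g = y" "cod1 (presented P) g = z" by (rule presented_MorE')
  from *(2) obtain t x y' where t: "f = mclass P t" "mtyp P t x y'" "dom1 (presented P) f = x" "cod1 (presented P) f = y'" by (rule presented_MorE')
  have "y' = y" using * s t by simp
  then show "comp1 (presented P) g f \<in> Mor (presented P) \<and> dom1 (presented P) (comp1 (presented P) g f) = dom1 (presented P) f \<and> cod1 (presented P) (comp1 (presented P) g f) = cod1 (presented P) g"
    using presented_comp1'[OF s(2)] t s by simp
next
  fix f assume *: "f \<in> Mor (presented P)"
  then obtain t x y where t: "f = mclass P t" "mtyp P t x y" "dom1 (presented P) f = x" "cod1 (presented P) f = y" by (rule presented_MorE')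
  then have i: "mtyp P (MId x) x x" "mtyp P (MId y) y y"
    by (auto dest: mtyp_obj intro: mtyp_id)
  show "comp1 (presented P) (id1 (presented P) (cod1 (presented P) f)) f = f \<and> comp1 (presented P) f (id1 (presented P) (dom1 (presented P) f)) = f"
    using presented_comp1[OF i(2) t(2)] presented_comp1[OF t(2) i(1)] mclass_eq[OF meq_unit_left[OF t(2)]] mclass_eq[OF meq_unit_right[OF t(2)]] presented_dom1[OF t(2)]
    unfolding presented_id1 t(1) by simp
next
  fix h g f assume *: "h \<in> Mor (presented P)" "g \<in> Mor (presented P)" "f \<in> Mor (presented P)" "dom1 (presented P) h = cod1 (presented P) g" "dom1 (presented P) g = cod1 (presented P) f"
  from *(1) obtain r z' w where r: "h = mclass P r" "mtyp P r z' w" "dom1 (presented P) h = z'" "cod1 (presented P) h = w" by (rule presented_MorE')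
  from *(2) obtain s y z where s: "g = mclass P s" "mtyp P s y z" "dom1 (presented P) g = y" "cod1 (presented P) g = z" by (rule presented_MorE')
  from *(3) obtain t x y' where t: "f = mclass P t" "mtyp P t x y'" "dom1 (presented P) f = x" "cod1 (presented P) f = y'" by (rule presented_MorE')
  have [simp]: "y' = y" "z' = z" using * r s t by simp_all
  note ty = r(2) s(2) t(2)
  note ty = ty[simplified]
  show "comp1 (presented P) (comp1 (presented P) h g) f = comp1 (presented P) h (comp1 (presented P) g f)"
    using presented_comp1[OF ty(1,2)] presented_comp1[OF ty(2,3)] presented_comp1[OF mtyp_comp[OF ty(1,2)] ty(3)] presented_comp1[OF ty(1) mtyp_comp[OF ty(2,3)]]
      mclass_eq[OF meq_assoc[OF mtyp_comp[OF mtyp_comp[OF ty(1,2)] ty(3)]]]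
    unfolding r(1) s(1) t(1) by simp
next
  fix f assume "f \<in> Mor (presented P)" 
  then show "id2 (presented P) f \<in> Cell (presented P) \<and> dom2 (presented P) (id2 (presented P) f) = f \<and> cod2 (presented P) (id2 (presented P) f) = f"
  proof (rule presented_MorE)
    fix t assume t: "f = mclass P t" "mtyp P t (dom1 (presented P) f) (cod1 (presented P) f)"
    show ?thesis using presented_id2[OF t(2)] presented_CellI[OF ctyp_id[OF t(2)]] presented_dom2[OF ctyp_id[OF t(2)]] t(1) by simp
  qed
next
  fix b a assume *: "b \<in> Cell (presented P)" "a \<in> Cell (presented P)" "dom2 (presented P) b = cod2 (presented P) a"
  from *(1) obtain s v' w where s: "b = cclass P s" "ctyp P s v' w" "dom2 (presented P) b = mclass P v'" "cod2 (presented P) b = mclass P w" "mtyp P v' (dom1 (presented P) (dom2 (presented P) b)) (cod1 (presented P) (dom2 (presented P) b))"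
    by (rule presented_CellE)
  from *(2) obtain t u v where t: "a = cclass P t" "ctyp P t u v" "dom2 (presented P) a = mclass P u" "cod2 (presented P) a = mclass P v"  by (rule presented_CellE)
  have "ctyp P s v w" using s t * ctyp_class_conv by simp
  then have "vcomp (presented P) b a = cclass P (VComp s t)" "ctyp P (VComp s t) u w" using s t by (auto simp: presented_vcomp intro: ctyp_vcomp)
  then show "vcomp (presented P) b a \<in> Cell (presented P) \<and> dom2 (presented P) (vcomp (presented P) b a) = dom2 (presented P) a \<and> cod2 (presented P) (vcomp (presented P) b a) = cod2 (presented P) b"
    using s t presented_CellI[of "VComp s t" u w] presented_dom2[of "VComp s t" u w] by simp
next
  fix a assume "a \<in> Cell (presented P)"
  then obtain t u v where t: "a = cclass P t" "ctyp P t u v" "dom2 (presented P) a = mclass P u" "cod2 (presented P) a = mclass P v"  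
    "mtyp P u (dom1 (presented P) (dom2 (presented P) a)) (cod1 (presented P) (dom2 (presented P) a))" "mtyp P v (dom1 (presented P) (dom2 (presented P) a)) (cod1 (presented P) (dom2 (presented P) a))" by (rule presented_CellE)
  then have "id2 (presented P) (cod2 (presented P) a) = cclass P (CId v)" "id2 (presented P) (dom2 (presented P) a) = cclass P (CId u)" using presented_id2[OF t(5)] presented_id2[OF t(6)] by simp_all
  then show "vcomp (presented P) (id2 (presented P) (cod2 (presented P) a)) a = a \<and> vcomp (presented P) a (id2 (presented P) (dom2 (presented P) a)) = a"
    using presented_vcomp[OF ctyp_id[OF t(6)] t(2)] presented_vcomp[OF t(2) ctyp_id[OF t(5)]] cclass_eq[OF ceq_vunit_left[OF t(2)]]
     cclass_eq[OF ceq_vunit_right[OF t(2)]] t(1) by simp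
next
  fix c b a assume *: "c \<in> Cell (presented P)" "b \<in> Cell (presented P)" "a \<in> Cell (presented P)" "dom2 (presented P) c = cod2 (presented P) b" "dom2 (presented P) b = cod2 (presented P) a"
  from *(1) obtain r w' w'' where r: "c = cclass P r" "ctyp P r w' w''" "dom2 (presented P) c = mclass P w'" "mtyp P w' (dom1 (presented P) (dom2 (presented P) c)) (cod1 (presented P) (dom2 (presented P) c))"
    by (rule presented_CellE)
  from *(2) obtain s v' w where s: "b = cclass P s" "ctyp P s v' w" "dom2 (presented P) b = mclass P v'" "cod2 (presented P) b = mclass P w" "mtyp P v' (dom1 (presented P) (dom2 (presented P) b)) (cod1 (presented P) (dom2 (presented P) b))"
    by (rule presented_CellE)
  from *(3) obtain t u v where t: "a = cclass P t" "ctyp P t u v" "dom2 (presented P) a = mclass P u" "cod2 (presented P) a = mclass P v"  by (rule presented_CellE)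
  have s': "ctyp P s v w" using s t * ctyp_class_conv by simp
  have r': "ctyp P r w w''" using s r * ctyp_class_conv by simp
  have e: "cclass P (VComp (VComp r s) t) = cclass P (VComp r (VComp s t))" using s' t r' by (meson cclass_eq ceq_vassoc ctyp_vcomp)
  have "vcomp (presented P) (vcomp (presented P) c b) a = cclass P (VComp (VComp r s) t)"
    using presented_vcomp[OF r' s'] presented_vcomp[OF ctyp_vcomp[OF r' s'] t(2)] t(1) r(1) s(1) by simp
  moreover have "vcomp (presented P) c (vcomp (presented P) b a) = cclass P (VComp r (VComp s t))"
    using presented_vcomp[OF s' t(2)] presented_vcomp[OF r' ctyp_vcomp[OF s' t(2)]] t(1) r(1) s(1) by simp
  ultimately show "vcomp (presented P) (vcomp (presented P) c b) a = vcomp (presented P) c (vcomp (presented P) b a)" using e by simp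
next
  fix b a assume *: "b \<in> Cell (presented P)" "a \<in> Cell (presented P)" "dom1 (presented P) (dom2 (presented P) b) = cod1 (presented P) (dom2 (presented P) a)"
  from *(1) obtain s u u' where s: "b = cclass P s" "ctyp P s u u'" "dom2 (presented P) b = mclass P u" "cod2 (presented P) b = mclass P u'"
     "mtyp P u (dom1 (presented P) (dom2 (presented P) b)) (cod1 (presented P) (dom2 (presented P) b))" "mtyp P u' (dom1 (presented P) (dom2 (presented P) b)) (cod1 (presented P) (dom2 (presented P) b))"
    by (rule presented_CellE)
  from *(2) obtain t v v' where t: "a = cclass P t" "ctyp P t v v'" "dom2 (presented P) a = mclass P v" "cod2 (presented P) a = mclass P v'"  
     "mtyp P v (dom1 (presented P) (dom2 (presented P) a)) (cod1 (presented P) (dom2 (presented P) a))" "mtyp P v' (dom1 (presented P) (dom2 (presented P) a)) (cod1 (presented P) (dom2 (presented P) a))" by (rule presented_CellE)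
  note tt = t(5,6)[folded *(3)]
  have "hcomp (presented P) b a = cclass P (HComp s t)" "ctyp P (HComp s t) (MComp u v) (MComp u' v')"
    using presented_hcomp[OF s(2) t(2) s(5) tt(1)] ctyp_hcompI[OF s(2) t(2) s(5) tt(1)] s(1) t(1) by simp_all
  moreover have "comp1 (presented P) (dom2 (presented P) b) (dom2 (presented P) a) = mclass P (MComp u v)" "comp1 (presented P) (cod2 (presented P) b) (cod2 (presented P) a) = mclass P (MComp u' v')"
    using presented_comp1[OF s(5) tt(1)] presented_comp1[OF s(6) tt(2)] s(3,4) t(3,4) by simp_all
  ultimately show "hcomp (presented P) b a \<in> Cell (presented P) \<and> dom2 (presented P) (hcomp (presented P) b a) = comp1 (presented P) (dom2 (presented P) b) (dom2 (presented P) a) \<and> cod2 (presented P) (hcomp (presented P) b a) = comp1 (presented P) (cod2 (presented P) b) (cod2 (presented P) a)"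
    using presented_CellI[of "HComp s t"] presented_dom2[of "HComp s t"] by simp
next
  fix a assume "a \<in> Cell (presented P)"
  then obtain t u v where t: "a = cclass P t" "ctyp P t u v" "dom2 (presented P) a = mclass P u" "cod2 (presented P) a = mclass P v"  
    "mtyp P u (dom1 (presented P) (dom2 (presented P) a)) (cod1 (presented P) (dom2 (presented P) a))" "mtyp P v (dom1 (presented P) (dom2 (presented P) a)) (cod1 (presented P) (dom2 (presented P) a))" by (rule presented_CellE)
  let ?x = "dom1 (presented P) (dom2 (presented P) a)" and ?y = "cod1 (presented P) (dom2 (presented P) a)"
  have i: "mtyp P (MId ?x) ?x ?x" "mtyp P (MId ?y) ?y ?y" using mtyp_obj[OF t(5)] by (auto intro: mtyp_id)
  then have "id2 (presented P) (id1 (presented P) ?x) = cclass P (CId (MId ?x))" "id2 (presented P) (id1 (presented P) ?y) = cclass P (CId (MId ?y))"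
    unfolding presented_id1 using presented_id2[OF i(1)] presented_id2[OF i(2)] by simp_all
  moreover have "hcomp (presented P) (cclass P (CId (MId ?y))) a = cclass P (HComp (CId (MId ?y)) t)" "hcomp (presented P) a (cclass P (CId (MId ?x))) = cclass P (HComp t (CId (MId ?x)))"
    using presented_hcomp[OF ctyp_id[OF i(2)] t(2) i(2) t(5)] presented_hcomp[OF t(2) ctyp_id[OF i(1)] t(5) i(1)] t(1) by simp_all
  ultimately show "hcomp (presented P) (id2 (presented P) (id1 (presented P) ?y)) a = a \<and> hcomp (presented P) a (id2 (presented P) (id1 (presented P) ?x)) = a"
    using cclass_eq[OF ceq_hunit_left[OF t(2,5)]] cclass_eq[OF ceq_hunit_right[OF t(2,5)]] t(1) by simp
next
  fix c b a assume *: "c \<in> Cell (presented P)" "b \<in> Cell (presented P)" "a \<in> Cell (presented P)" "dom1 (presented P) (dom2 (presented P) c) = cod1 (presented P) (dom2 (presented P) b)" "dom1 (presented P) (dom2 (presented P) b) = cod1 (presented P) (dom2 (presented P) a)"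
  from *(1) obtain r w w' where r: "c = cclass P r" "ctyp P r w w'" "dom2 (presented P) c = mclass P w"  "cod2 (presented P) c = mclass P w'"
     "mtyp P w (dom1 (presented P) (dom2 (presented P) c)) (cod1 (presented P) (dom2 (presented P) c))" by (rule presented_CellE)
  from *(2) obtain s u u' where s: "b = cclass P s" "ctyp P s u u'" "dom2 (presented P) b = mclass P u" "cod2 (presented P) b = mclass P u'"
     "mtyp P u (dom1 (presented P) (dom2 (presented P) b)) (cod1 (presented P) (dom2 (presented P) b))" by (rule presented_CellE)
  from *(3) obtain t v v' where t: "a = cclass P t" "ctyp P t v v'" "dom2 (presented P) a = mclass P v" "cod2 (presented P) a = mclass P v'"  
     "mtyp P v (dom1 (presented P) (dom2 (presented P) a)) (cod1 (presented P) (dom2 (presented P) a))" by (rule presented_CellE)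
  note ty = r(5) s(5)[folded *(4)] t(5)[folded *(5)]
  have e: "ceq P (HComp (HComp r s) t) (HComp r (HComp s t))"
    by (rule ceq_hassoc[OF ctyp_hcompI[OF ctyp_hcompI[OF r(2) s(2) ty(1,2)] t(2) mtyp_comp[OF ty(1,2)] ty(3)]])
  have "hcomp (presented P) (hcomp (presented P) c b) a = cclass P (HComp (HComp r s) t)"
    using presented_hcomp[OF r(2) s(2) ty(1,2)] presented_hcomp[OF ctyp_hcompI[OF r(2) s(2) ty(1,2)] t(2) mtyp_comp[OF ty(1,2)] ty(3)] r(1) s(1) t(1) by simp
  moreover have "hcomp (presented P) c (hcomp (presented P) b a) = cclass P (HComp r (HComp s t))"
    using presented_hcomp[OF s(2) t(2) ty(2,3)] presented_hcomp[OF r(2) ctyp_hcompI[OF s(2) t(2) ty(2,3)] ty(1) mtyp_comp[OF ty(2,3)]] r(1) s(1) t(1) by simp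
  ultimately show "hcomp (presented P) (hcomp (presented P) c b) a = hcomp (presented P) c (hcomp (presented P) b a)" using cclass_eq[OF e] by simp
next
  fix g f assume *: "g \<in> Mor (presented P)" "f \<in> Mor (presented P)" "dom1 (presented P) g = cod1 (presented P) f"
  obtain s t where st: "g = mclass P s" "f = mclass P t" "mtyp P s (dom1 (presented P) g) (cod1 (presented P) g)" "mtyp P t (dom1 (presented P) f) (dom1 (presented P) g)"
    using * presented_MorE by metis
  show "hcomp (presented P) (id2 (presented P) g) (id2 (presented P) f) = id2 (presented P) (comp1 (presented P) g f)"
    using presented_id2[OF st(3)] presented_id2[OF st(4)] presented_hcomp[OF ctyp_id[OF st(3)] ctyp_id[OF st(4)] st(3,4)] 
      presented_comp1[OF st(3,4)] presented_id2[OF mtyp_comp[OF st(3,4)]] cclass_eq[OF ceq_hid[OF mtyp_comp[OF st(3,4)]]] st(1,2) by simp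
next
  fix b' b a' a assume *: "b' \<in> Cell (presented P)" "b \<in> Cell (presented P)" "a' \<in> Cell (presented P)" "a \<in> Cell (presented P)" "dom2 (presented P) b' = cod2 (presented P) b" "dom2 (presented P) a' = cod2 (presented P) a"
    "dom1 (presented P) (dom2 (presented P) b) = cod1 (presented P) (dom2 (presented P) a)"
  from *(1) obtain s' m' u' where s': "b' = cclass P s'" "ctyp P s' m' u'" "dom2 (presented P) b' = mclass P m'" "mtyp P m' (dom1 (presented P) (dom2 (presented P) b')) (cod1 (presented P) (dom2 (presented P) b'))" by (rule presented_CellE)
  from *(2) obtain s u m where s: "b = cclass P s" "ctyp P s u m" "dom2 (presented P) b = mclass P u" "cod2 (presented P) b = mclass P m" 
     "mtyp P u (dom1 (presented P) (dom2 (presented P) b)) (cod1 (presented P) (dom2 (presented P) b))" "mtyp P m (dom1 (presented P) (dom2 (presented P) b)) (cod1 (presented P) (dom2 (presented P) b))" by (rule presented_CellE)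
  from *(3) obtain t' n' v' where t': "a' = cclass P t'" "ctyp P t' n' v'" "dom2 (presented P) a' = mclass P n'" "mtyp P n' (dom1 (presented P) (dom2 (presented P) a')) (cod1 (presented P) (dom2 (presented P) a'))" by (rule presented_CellE)
  from *(4) obtain t v n where t: "a = cclass P t" "ctyp P t v n" "dom2 (presented P) a = mclass P v" "cod2 (presented P) a = mclass P n"  
     "mtyp P v (dom1 (presented P) (dom2 (presented P) a)) (cod1 (presented P) (dom2 (presented P) a))" "mtyp P n (dom1 (presented P) (dom2 (presented P) a)) (cod1 (presented P) (dom2 (presented P) a))" by (rule presented_CellE)
  have s2: "ctyp P s' m u'" using s s' * ctyp_class_conv by simp
  have t2: "ctyp P t' n v'" using t t' * ctyp_class_conv by simp
  note ty = s(5,6) t(5,6)[folded *(7)]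
  have e: "ceq P (HComp (VComp s' s) (VComp t' t)) (VComp (HComp s' t') (HComp s t))"
    by (rule ceq_interchange[OF ctyp_hcompI[OF ctyp_vcomp[OF s2 s(2)] ctyp_vcomp[OF t2 t(2)] ty(1,3)]])
  have 1: "vcomp (presented P) b' b = cclass P (VComp s' s)" "vcomp (presented P) a' a = cclass P (VComp t' t)"
     "ctyp P (VComp s' s) u u'" "ctyp P (VComp t' t) v v'"
    using s(2) t(2) s2 t2 unfolding s(1) t(1) s'(1) t'(1) by (auto simp: presented_vcomp intro: ctyp_vcomp)
  have 2: "hcomp (presented P) b' a' = cclass P (HComp s' t')" "hcomp (presented P) b a = cclass P (HComp s t)"
     "ctyp P (HComp s' t') (MComp m n) (MComp u' v')" "ctyp P (HComp s t) (MComp u v) (MComp m n)"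
    using presented_hcomp[OF s2 t2 ty(2,4)] presented_hcomp[OF s(2) t(2) ty(1,3)] ctyp_hcompI[OF s2 t2 ty(2,4)] ctyp_hcompI[OF s(2) t(2) ty(1,3)] s(1) t(1) s'(1) t'(1) by simp_all
  have "hcomp (presented P) (vcomp (presented P) b' b) (vcomp (presented P) a' a) = cclass P (HComp (VComp s' s) (VComp t' t))"
    using presented_hcomp[OF 1(3,4) ty(1,3)] 1(1,2) by simp
  moreover have "vcomp (presented P) (hcomp (presented P) b' a') (hcomp (presented P) b a) = cclass P (VComp (HComp s' t') (HComp s t))"
    using presented_vcomp[OF 2(3,4)] 2(1,2) by simp
  ultimately show "hcomp (presented P) (vcomp (presented P) b' b) (vcomp (presented P) a' a) = vcomp (presented P) (hcomp (presented P) b' a') (hcomp (presented P) b a)"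
    using cclass_eq[OF e] by simp
qed

end


section \<open>The diagram\<close>

datatype shape_obj = SB | SA | SC

datatype shape_arr = SId shape_obj | SBA | SCA

fun shape_comp :: "shape_arr \<Rightarrow> shape_arr \<Rightarrow> shape_arr" where
  "shape_comp (SId i) f = f"
| "shape_comp g f = g"

definition pullback_shape :: "(shape_obj, shape_arr) cat" where
  "pullback_shape = \<lparr>Ob = UNIV, Ar = UNIV,
     Dom = (\<lambda>f. case f of SId i \<Rightarrow> i | SBA \<Rightarrow> SB | SCA \<Rightarrow> SC),
     Cod = (\<lambda>f. case f of SId i \<Rightarrow> i | SBA \<Rightarrow> SA | SCA \<Rightarrow> SA),
     Idt = SId, Cmp = shape_comp\<rparr>"

lemma category_pullback_shape: "category pullback_shape"
  by (auto simp: category_def pullback_shape_def split: shape_arr.splits)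

datatype ex_obj = oX | oL | oA | oB | oC
datatype ex_mor = mf | ml0 | ml1 | ma0 | ma1 | mb | mc
datatype ex_cell = g0 | g1

text \<open>The relation \<open>b * \<gamma>\<^sub>0 = c * \<gamma>\<^sub>1\<close> says that \<open>\<gamma>\<^sub>0\<close> and \<open>\<gamma>\<^sub>1\<close> are the components of a
  modification from \<open>\<lambda> \<Delta>f\<close> to the 2-cone \<open>\<alpha>\<close>. The informal statement lists only the two
  relations between morphisms; with those alone its conclusion is false, by
  \<open>no_modification_without_relation\<close> below.\<close>

definition ex_presentation :: "(ex_obj, ex_mor, ex_cell) presentation" where
  "ex_presentation = \<lparr>
     gen_obj = UNIV,
     gen_mor = UNIV,
     gen_dom = (\<lambda>g. case g of mf \<Rightarrow> oX | ml0 \<Rightarrow> oL | ml1 \<Rightarrow> oL | ma0 \<Rightarrow> oX | ma1 \<Rightarrow> oX | mb \<Rightarrow> oB | mc \<Rightarrow> oC),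
     gen_cod = (\<lambda>g. case g of mf \<Rightarrow> oL | ml0 \<Rightarrow> oB | ml1 \<Rightarrow> oC | ma0 \<Rightarrow> oB | ma1 \<Rightarrow> oC | mb \<Rightarrow> oA | mc \<Rightarrow> oA),
     rel_mor = {(MComp (MGen mb) (MGen ml0), MComp (MGen mc) (MGen ml1)),
                (MComp (MGen mb) (MGen ma0), MComp (MGen mc) (MGen ma1))},
     gen_cell = UNIV,
     gen_src = (\<lambda>h. case h of g0 \<Rightarrow> MComp (MGen ml0) (MGen mf) | g1 \<Rightarrow> MComp (MGen ml1) (MGen mf)),
     gen_tgt = (\<lambda>h. case h of g0 \<Rightarrow> MGen ma0 | g1 \<Rightarrow> MGen ma1),
     gen_inv = UNIV,
     rel_cell = {(HComp (CId (MGen mb)) (CGen g0), HComp (CId (MGen mc)) (CGen g1))}\<rparr>"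

definition ex_two_cat ::
  "(ex_obj, (ex_obj, ex_mor) mterm set, (ex_obj, ex_mor, ex_cell) cterm set) two_cat" where
  "ex_two_cat = presented ex_presentation"

lemma two_category_ex: "two_category ex_two_cat"
  unfolding ex_two_cat_def by (rule presented_two_category)

definition ex_gen :: "ex_mor \<Rightarrow> (ex_obj, ex_mor) mterm set" where
  "ex_gen g = mclass ex_presentation (MGen g)"

definition ex_shape :: "(shape_obj, shape_arr, shape_arr) two_cat" where
  "ex_shape = discrete_two_cat pullback_shape"

lemma two_category_ex_shape: "two_category ex_shape"
  unfolding ex_shape_def by (rule two_category_discrete[OF category_pullback_shape])

definition ex_diagram_obj :: "shape_obj \<Rightarrow> ex_obj" where
  "ex_diagram_obj i = (case i of SB \<Rightarrow> oB | SA \<Rightarrow> oA | SC \<Rightarrow> oC)"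

definition ex_diagram_mor :: "shape_arr \<Rightarrow> (ex_obj, ex_mor) mterm set" where
  "ex_diagram_mor f = (case f of SId i \<Rightarrow> id1 ex_two_cat (ex_diagram_obj i)
     | SBA \<Rightarrow> ex_gen mb | SCA \<Rightarrow> ex_gen mc)"

definition ex_diagram ::
  "(shape_obj, shape_arr, shape_arr, ex_obj, (ex_obj, ex_mor) mterm set,
    (ex_obj, ex_mor, ex_cell) cterm set) two_fun" where
  "ex_diagram = \<lparr>on_obj = ex_diagram_obj, on_mor = ex_diagram_mor,
     on_cell = (\<lambda>f. id2 ex_two_cat (ex_diagram_mor f))\<rparr>"

definition ex_cone ::
  "(shape_obj, shape_arr, shape_arr, ex_obj, (ex_obj, ex_mor) mterm set,
    (ex_obj, ex_mor, ex_cell) cterm set) transf" where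
  "ex_cone = \<lparr>tdom = diag_obj ex_shape ex_two_cat oL, tcod = ex_diagram,
     tcmp = (\<lambda>i. case i of SB \<Rightarrow> ex_gen ml0 | SC \<Rightarrow> ex_gen ml1
               | SA \<Rightarrow> ex_gen mb \<odot>\<^bsub>ex_two_cat\<^esub> ex_gen ml0)\<rparr>"

text \<open>Without the relation \<open>b * \<gamma>\<^sub>0 = c * \<gamma>\<^sub>1\<close>, no pair of 2-morphisms \<open>\<lambda>\<^sub>0 u \<Rightarrow> \<alpha>\<^sub>0\<close> and
  \<open>\<lambda>\<^sub>1 u \<Rightarrow> \<alpha>\<^sub>1\<close> is compatible at \<open>A\<close>, so that there is no modification \<open>\<lambda> \<Delta>u \<rightarrow> \<alpha>\<close> for any
  \<open>u : X \<rightarrow> L\<close>, and \<open>(L, \<lambda>)\<close> is not 2-terminal in the pseudo-slice. The proof counts occurrences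
  of \<open>\<gamma>\<^sub>0\<close> with sign.\<close>

fun cell_weight :: "(ex_obj, ex_mor, ex_cell) cterm \<Rightarrow> int" where
  "cell_weight (CId u) = 0"
| "cell_weight (CGen h) = (if h = g0 then 1 else 0)"
| "cell_weight (CInv h) = (if h = g0 then -1 else 0)"
| "cell_weight (VComp s t) = cell_weight s + cell_weight t"
| "cell_weight (HComp s t) = cell_weight s + cell_weight t"

fun mor_weight :: "(ex_obj, ex_mor) mterm \<Rightarrow> int" where
  "mor_weight (MId x) = 0"
| "mor_weight (MGen g) = (if g = ma0 then 1 else 0)"
| "mor_weight (MComp s t) = mor_weight s + mor_weight t"

abbreviation "ex_free \<equiv> ex_presentation\<lparr>rel_cell := {}\<rparr>"

lemma cell_weight_cong: "ceq ex_free s t \<Longrightarrow> cell_weight s = cell_weight t"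
  by (induction rule: ceq.induct) (auto simp: ex_presentation_def)

lemma ex_mtyp_from_A: "mtyp ex_free u x y \<Longrightarrow> x = oA \<Longrightarrow> y = oA"
  by (induction rule: mtyp.induct) (auto simp: ex_presentation_def split: ex_mor.splits)

lemma ex_mtyp_to_L: "mtyp ex_free u x y \<Longrightarrow> y \<in> {oX, oL} \<Longrightarrow> x \<in> {oX, oL} \<and> mor_weight u = 0"
  by (induction rule: mtyp.induct) (auto simp: ex_presentation_def split: ex_mor.splits)

lemma mor_weight_cong: "meq ex_free u v \<Longrightarrow> mtyp ex_free u x y \<Longrightarrow> y \<noteq> oA \<Longrightarrow> mor_weight u = mor_weight v"
proof (induction arbitrary: x y rule: meq.induct)
  case (meq_sym s t) then show ?case by (metis meq_mtyp')
next
  case (meq_trans r s t) then show ?case by (metis meq_mtyp)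
next
  case (meq_cong s s' t t' a b)
  from meq_cong.prems(1) obtain z where "mtyp ex_free s z y" "mtyp ex_free t x z" by (rule mtyp_compE)
  moreover have "z \<noteq> oA" using calculation(1) meq_cong.prems(2) ex_mtyp_from_A by blast
  ultimately show ?case using meq_cong.IH meq_cong.prems(2) by simp
next
  case (meq_rel s t a b)
  then have "y = oA" by (auto simp: ex_presentation_def elim!: mtyp_compE mtyp_genE)
  with meq_rel show ?case by simp
qed auto

lemma cell_weight_eq: "ctyp ex_free t u v \<Longrightarrow> mtyp ex_free u x y \<Longrightarrow> y \<noteq> oA \<Longrightarrow>
  cell_weight t = mor_weight v - mor_weight u"
proof (induction arbitrary: x y rule: ctyp.induct)
  case (ctyp_gen h a b) then show ?case by (cases h) (auto simp: ex_presentation_def)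
next
  case (ctyp_inv h a b) then show ?case by (cases h) (auto simp: ex_presentation_def)
next
  case (ctyp_vcomp s v w t u)
  then have "mtyp ex_free v x y" by (metis ctyp_par mtyp_unique)
  with ctyp_vcomp show ?case by fastforce
next
  case (ctyp_hcomp s u u' t v v' a b)
  from ctyp_hcomp.prems(1) obtain z where z: "mtyp ex_free u z y" "mtyp ex_free v x z" by (rule mtyp_compE)
  moreover have "z \<noteq> oA" using z(1) ctyp_hcomp.prems(2) ex_mtyp_from_A by blast
  ultimately show ?case using ctyp_hcomp.IH ctyp_hcomp.prems(2) by fastforce
next
  case (ctyp_conv t u v u' v')
  have u: "mtyp ex_free u x y" by (rule meq_mtyp'[OF ctyp_conv.hyps(2) ctyp_conv.prems(1)])
  moreover have "mtyp ex_free v x y" using ctyp_par[OF ctyp_conv.hyps(1)] mtyp_unique[OF u] by blast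
  ultimately show ?case using ctyp_conv.IH[OF u ctyp_conv.prems(2)] ctyp_conv.prems(2)
    mor_weight_cong[OF ctyp_conv.hyps(2)] mor_weight_cong[OF ctyp_conv.hyps(3)] by simp
qed auto

lemma no_modification_without_relation:
  assumes "mtyp ex_free u oX oL"
    and "ctyp ex_free s (MComp (MGen ml0) u) (MGen ma0)"
    and "ctyp ex_free t (MComp (MGen ml1) u) (MGen ma1)"
  shows "\<not> ceq ex_free (HComp (CId (MGen mb)) s) (HComp (CId (MGen mc)) t)"
proof -
  have "mtyp ex_free (MGen ma0) oX oB" "mtyp ex_free (MGen ma1) oX oC"
    using mtyp_gen[of ma0 ex_free] mtyp_gen[of ma1 ex_free] by (auto simp: ex_presentation_def)
  then have "mtyp ex_free (MComp (MGen ml0) u) oX oB" "mtyp ex_free (MComp (MGen ml1) u) oX oC"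
    using ctyp_par[OF assms(2)] ctyp_par[OF assms(3)] by (blast dest: mtyp_unique)+
  then have "cell_weight s = 1" "cell_weight t = 0"
    using cell_weight_eq[OF assms(2)] cell_weight_eq[OF assms(3)] ex_mtyp_to_L[OF assms(1)] by simp_all
  then show ?thesis using cell_weight_cong by fastforce
qed

end

theory Submission
  imports Defs
begin

text \<open>Between any two parallel morphisms of the example there is exactly one 2-morphism: the hom-categories
  \<open>(X,B)\<close>, \<open>(X,C)\<close> and \<open>(X,A)\<close> consist of two objects joined by the isomorphism \<open>\<gamma>\<^sub>0\<close>, \<open>\<gamma>\<^sub>1\<close> and
  \<open>b * \<gamma>\<^sub>0 = c * \<gamma>\<^sub>1\<close>, and all others have at most one object and no non-identity 2-morphism.
  Hence any two parallel 2-cones are related by exactly one modification, and \<open>(L, \<lambda>)\<close> is 2-terminal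
  as soon as the apex of every cone has exactly one morphism to \<open>L\<close>. Only \<open>X\<close> and \<open>L\<close> are
  apices, and \<open>f\<close> and the identity are the only morphisms. On the other hand the cone \<open>\<alpha>\<close> is isomorphic
  but not equal to \<open>\<lambda> \<Delta>f\<close>, because the number of occurrences of \<open>\<alpha>\<^sub>0\<close> and \<open>\<alpha>\<^sub>1\<close> in a
  composite is respected by both relations; so post-composition with \<open>\<lambda>\<close> is not surjective.\<close>

section \<open>Locally indiscrete 2-categories\<close>

text \<open>Every hom-category is indiscrete, so each equation between 2-morphisms reduces to an
  equation between their boundaries. The pseudo-slice argument rests on this property alone; that
  the example has it is shown afterwards.\<close>

locale locally_indiscrete = two_category A for A :: "('p, 'n, 'd) two_cat" (structure) +
  assumes cell_unique: "\<lbrakk>K \<in> Cell A; K' \<in> Cell A; dom2 A K = dom2 A K'; cod2 A K = cod2 A K'\<rbrakk> \<Longrightarrow> K = K'"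
    and cell_exists: "\<lbrakk>u \<in> Mor A; v \<in> Mor A; dom1 A u = dom1 A v; cod1 A u = cod1 A v\<rbrakk> \<Longrightarrow>
      \<exists>K\<in>Cell A. dom2 A K = u \<and> cod2 A K = v"
begin

lemma hcomp_eqI:
  assumes "b \<in> Cell A" "a \<in> Cell A" "b' \<in> Cell A" "a' \<in> Cell A"
    and "dom1 A (dom2 A b) = cod1 A (dom2 A a)" "dom1 A (dom2 A b') = cod1 A (dom2 A a')"
    and "dom2 A b \<odot> dom2 A a = dom2 A b' \<odot> dom2 A a'" "cod2 A b \<odot> cod2 A a = cod2 A b' \<odot> cod2 A a'"
  shows "b \<star> a = b' \<star> a'"
  using hcomp_closed[OF assms(1,2,5)] hcomp_closed[OF assms(3,4,6)] assms(7,8)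
  by (intro cell_unique) simp_all

text \<open>Compatibility with the 2-morphisms of \<open>I\<close> is not a premise: it equates parallel 2-morphisms of \<open>A\<close>.\<close>

lemma two_naturalI:
  assumes I: "two_category I" and "two_functor I A (tdom \<mu>)" "two_functor I A (tcod \<mu>)"
    and "tcmp \<mu> \<in> extensional (Obj I)"
    and cmp: "\<And>i. i \<in> Obj I \<Longrightarrow> tcmp \<mu> i \<in> Mor A \<and>
       dom1 A (tcmp \<mu> i) = on_obj (tdom \<mu>) i \<and> cod1 A (tcmp \<mu> i) = on_obj (tcod \<mu>) i"
    and nat: "\<And>f. f \<in> Mor I \<Longrightarrow> on_mor (tcod \<mu>) f \<odot> tcmp \<mu> (dom1 I f) = tcmp \<mu> (cod1 I f) \<odot> on_mor (tdom \<mu>) f"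
  shows "two_natural I A \<mu>"
proof -
  have "on_cell (tcod \<mu>) a \<star> id2 A (tcmp \<mu> (dom1 I (dom2 I a))) =
       id2 A (tcmp \<mu> (cod1 I (dom2 I a))) \<star> on_cell (tdom \<mu>) a" if a: "a \<in> Cell I" for a
  proof -
    note e = two_category.cell_ends[OF I a]
    then have o: "dom1 I (dom2 I a) \<in> Obj I" "cod1 I (dom2 I a) \<in> Obj I"
      using two_category.mor_ends[OF I] by blast+
    have F: "on_cell G a \<in> Cell A" "dom2 A (on_cell G a) = on_mor G (dom2 I a)"
      "cod2 A (on_cell G a) = on_mor G (cod2 I a)"
      "dom1 A (on_mor G (dom2 I a)) = on_obj G (dom1 I (dom2 I a))"
      "cod1 A (on_mor G (dom2 I a)) = on_obj G (cod1 I (dom2 I a))"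
      if "two_functor I A G" for G
      using that a e unfolding two_functor_def by blast+
    note c = cmp[OF o(1)] cmp[OF o(2)]
    have i: "id2 A (tcmp \<mu> j) \<in> Cell A" "dom2 A (id2 A (tcmp \<mu> j)) = tcmp \<mu> j"
      "cod2 A (id2 A (tcmp \<mu> j)) = tcmp \<mu> j" if "j \<in> Obj I" for j
      using id2_closed[of "tcmp \<mu> j"] cmp[OF that] by blast+
    show ?thesis
      using nat[of "dom2 I a"] nat[of "cod2 I a"] e c o
      by (intro hcomp_eqI) (simp_all add: F[OF assms(2)] F[OF assms(3)] i)
  qed
  then show ?thesis
    using assms unfolding two_natural_def by blast
qed

text \<open>Makes \<open>lam\<close> after the constant transformation at \<open>u\<close> available
  as the source of a modification. The cone \<open>\<mu>\<close> enters through its source: it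
  guarantees that the constant diagram at \<open>x\<close> is a 2-functor.\<close>

lemma cone_comp:
  assumes I: "two_category I" and lam: "two_cone I A F l lam" and \<mu>: "two_cone I A F x \<mu>"
    and u: "u \<in> Mor A" "dom1 A u = x" "cod1 A u = l"
  shows "two_natural I A (transf_comp I A lam (diag_mor I A u))"
proof (rule two_naturalI[OF I])
  have c: "tcmp lam i \<in> Mor A" "dom1 A (tcmp lam i) = l" "cod1 A (tcmp lam i) = on_obj F i"
    if "i \<in> Obj I" for i
    using lam that unfolding two_cone_def two_natural_def diag_obj_def by auto
  show "two_functor I A (tdom (transf_comp I A lam (diag_mor I A u)))"
    "two_functor I A (tcod (transf_comp I A lam (diag_mor I A u)))"
  proof -
    have "two_functor I A (tdom \<mu>)" "tdom \<mu> = diag_obj I A x" "two_functor I A (tcod lam)"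
      using lam \<mu> unfolding two_cone_def two_natural_def by blast+
    then show "two_functor I A (tdom (transf_comp I A lam (diag_mor I A u)))"
      "two_functor I A (tcod (transf_comp I A lam (diag_mor I A u)))"
      using u by (simp_all add: transf_comp_def diag_mor_def)
  qed
  show "tcmp (transf_comp I A lam (diag_mor I A u)) \<in> extensional (Obj I)"
    by (simp add: transf_comp_def)
  fix i assume i: "i \<in> Obj I"
  show "tcmp (transf_comp I A lam (diag_mor I A u)) i \<in> Mor A \<and>
     dom1 A (tcmp (transf_comp I A lam (diag_mor I A u)) i) = on_obj (tdom (transf_comp I A lam (diag_mor I A u))) i \<and>
     cod1 A (tcmp (transf_comp I A lam (diag_mor I A u)) i) = on_obj (tcod (transf_comp I A lam (diag_mor I A u))) i"
    using c[OF i] i u comp1_closed[of "tcmp lam i" u] lam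
    by (simp add: transf_comp_def diag_mor_def diag_obj_def two_cone_def)
next
  fix f assume f: "f \<in> Mor I"
  let ?i = "dom1 I f" and ?j = "cod1 I f"
  have o: "?i \<in> Obj I" "?j \<in> Obj I"
    using two_category.mor_ends[OF I f] by auto
  \<comment> \<open>The constant diagram at \<open>l\<close> sends \<open>f\<close> to the identity,
    so naturality of \<open>lam\<close> says that composing a leg with \<open>on_mor F f\<close>
    gives the other leg. Precomposing with \<open>u\<close> preserves this.\<close>
  have n: "on_mor F f \<odot> tcmp lam ?i = tcmp lam ?j \<odot> id1 A l"
    and t: "tcod lam = F" "tdom lam = diag_obj I A l" and F: "two_functor I A F"
    using lam f unfolding two_cone_def two_natural_def diag_obj_def by auto
  have c: "tcmp lam i \<in> Mor A" "dom1 A (tcmp lam i) = l" "cod1 A (tcmp lam i) = on_obj F i"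
    if "i \<in> Obj I" for i
    using lam that unfolding two_cone_def two_natural_def diag_obj_def by auto
  have Ff: "on_mor F f \<in> Mor A" "dom1 A (on_mor F f) = on_obj F ?i"
    using F f unfolding two_functor_def by auto
  have "on_mor F f \<odot> (tcmp lam ?i \<odot> u) = (on_mor F f \<odot> tcmp lam ?i) \<odot> u"
    using comp1_assoc[OF Ff(1) c(1)[OF o(1)] u(1)] c[OF o(1)] Ff u by simp
  also have "\<dots> = tcmp lam ?j \<odot> u"
    using n comp1_unit[OF c(1)[OF o(2)]] c(2)[OF o(2)] by simp
  also have "\<dots> = (tcmp lam ?j \<odot> u) \<odot> id1 A x"
    using comp1_closed[OF c(1)[OF o(2)] u(1)] comp1_unit[of "tcmp lam ?j \<odot> u"] c(2)[OF o(2)] u by simp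
  finally show "on_mor (tcod (transf_comp I A lam (diag_mor I A u))) f \<odot>
      tcmp (transf_comp I A lam (diag_mor I A u)) ?i =
    tcmp (transf_comp I A lam (diag_mor I A u)) ?j \<odot> on_mor (tdom (transf_comp I A lam (diag_mor I A u))) f"
    using f o u t by (simp add: transf_comp_def diag_mor_def diag_obj_def)
qed

section \<open>Modifications between parallel 2-natural transformations\<close>

lemma modification_unique:
  assumes "modification I A \<phi>" "modification I A \<psi>" "mdom \<phi> = mdom \<psi>" "mcod \<phi> = mcod \<psi>"
  shows "\<phi> = \<psi>"
proof -
  have "mcmp \<phi> = mcmp \<psi>"
  proof (rule extensionalityI)
    show "mcmp \<phi> \<in> extensional (Obj I)" "mcmp \<psi> \<in> extensional (Obj I)"
      using assms unfolding modification_def by blast+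
    fix i assume i: "i \<in> Obj I"
    show "mcmp \<phi> i = mcmp \<psi> i"
      using assms i unfolding modification_def by (intro cell_unique) simp_all
  qed
  with assms(3,4) show ?thesis
    by (simp add: modif.equality)
qed

text \<open>Naturality of the source and of the target gives the two sides of the modification axiom
  the same boundary, so the axiom holds for any family of components of the right type.\<close>

lemma modificationI:
  assumes I: "two_category I" and \<mu>: "two_natural I A (mdom \<phi>)" and \<nu>: "two_natural I A (mcod \<phi>)"
    and t: "tdom (mdom \<phi>) = tdom (mcod \<phi>)" "tcod (mdom \<phi>) = tcod (mcod \<phi>)"
    and ext: "mcmp \<phi> \<in> extensional (Obj I)"
    and cmp: "\<And>i. i \<in> Obj I \<Longrightarrow> mcmp \<phi> i \<in> Cell A \<and>
       dom2 A (mcmp \<phi> i) = tcmp (mdom \<phi>) i \<and> cod2 A (mcmp \<phi> i) = tcmp (mcod \<phi>) i"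
  shows "modification I A \<phi>"
proof -
  have "id2 A (on_mor (tcod (mdom \<phi>)) f) \<star> mcmp \<phi> (dom1 I f) =
       mcmp \<phi> (cod1 I f) \<star> id2 A (on_mor (tdom (mdom \<phi>)) f)" if f: "f \<in> Mor I" for f
  proof -
    have o: "dom1 I f \<in> Obj I" "cod1 I f \<in> Obj I"
      using two_category.mor_ends[OF I f] by auto
    have F: "on_mor G f \<in> Mor A" "dom1 A (on_mor G f) = on_obj G (dom1 I f)"
      "cod1 A (on_mor G f) = on_obj G (cod1 I f)" if "two_functor I A G" for G
      using that f unfolding two_functor_def by blast+
    have i: "id2 A (on_mor G f) \<in> Cell A" "dom2 A (id2 A (on_mor G f)) = on_mor G f"
      "cod2 A (id2 A (on_mor G f)) = on_mor G f" if "two_functor I A G" for G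
      using id2_closed[OF F(1)[OF that]] by blast+
    have G: "two_functor I A (tcod (mdom \<phi>))" "two_functor I A (tdom (mdom \<phi>))"
      using \<mu> unfolding two_natural_def by blast+
    have c: "tcmp (mdom \<phi>) j \<in> Mor A" "dom1 A (tcmp (mdom \<phi>) j) = on_obj (tdom (mdom \<phi>)) j"
      "cod1 A (tcmp (mdom \<phi>) j) = on_obj (tcod (mdom \<phi>)) j" if "j \<in> Obj I" for j
      using \<mu> that unfolding two_natural_def by blast+
    have n: "on_mor (tcod (mdom \<phi>)) f \<odot> tcmp (mdom \<phi>) (dom1 I f) = tcmp (mdom \<phi>) (cod1 I f) \<odot> on_mor (tdom (mdom \<phi>)) f"
      using \<mu> f unfolding two_natural_def by blast
    have n': "on_mor (tcod (mdom \<phi>)) f \<odot> tcmp (mcod \<phi>) (dom1 I f) = tcmp (mcod \<phi>) (cod1 I f) \<odot> on_mor (tdom (mdom \<phi>)) f"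
      using \<nu> f unfolding two_natural_def t by blast
    show ?thesis
      by (rule hcomp_eqI)
        (simp_all add: cmp[OF o(1)] cmp[OF o(2)] i[OF G(1)] i[OF G(2)] F[OF G(1)] F[OF G(2)] c[OF o(1)] c[OF o(2)] n n')
  qed
  then show ?thesis
    using assms unfolding modification_def by blast
qed

text \<open>Components can be chosen independently at each object of \<open>I\<close>, since no
  coherence between them has to be arranged.\<close>

lemma modification_exists:
  assumes I: "two_category I" and \<mu>: "two_natural I A \<mu>" and \<nu>: "two_natural I A \<nu>"
    and t: "tdom \<mu> = tdom \<nu>" "tcod \<mu> = tcod \<nu>"
  obtains \<phi> where "modification I A \<phi>" "mdom \<phi> = \<mu>" "mcod \<phi> = \<nu>"
proof -
  have "\<exists>K\<in>Cell A. dom2 A K = tcmp \<mu> i \<and> cod2 A K = tcmp \<nu> i" if i: "i \<in> Obj I" for i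
  proof (rule cell_exists)
    have *: "tcmp \<rho> i \<in> Mor A" "dom1 A (tcmp \<rho> i) = on_obj (tdom \<rho>) i" "cod1 A (tcmp \<rho> i) = on_obj (tcod \<rho>) i"
      if "two_natural I A \<rho>" for \<rho>
      using that i unfolding two_natural_def by blast+
    show "tcmp \<mu> i \<in> Mor A" "tcmp \<nu> i \<in> Mor A" "dom1 A (tcmp \<mu> i) = dom1 A (tcmp \<nu> i)"
      "cod1 A (tcmp \<mu> i) = cod1 A (tcmp \<nu> i)"
      using *[OF \<mu>] *[OF \<nu>] t by simp_all
  qed
  then obtain K where K: "\<And>i. i \<in> Obj I \<Longrightarrow> K i \<in> Cell A \<and> dom2 A (K i) = tcmp \<mu> i \<and> cod2 A (K i) = tcmp \<nu> i"
    by metis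
  have "modification I A \<lparr>mdom = \<mu>, mcod = \<nu>, mcmp = restrict K (Obj I)\<rparr>"
    by (rule modificationI[OF I]) (use assms K in simp_all)
  then show thesis
    by (rule that) simp_all
qed

lemma modification_cmp:
  assumes "modification I A \<phi>" "i \<in> Obj I"
  shows "mcmp \<phi> i \<in> Cell A" "dom2 A (mcmp \<phi> i) = tcmp (mdom \<phi>) i" "cod2 A (mcmp \<phi> i) = tcmp (mcod \<phi>) i"
  using assms unfolding modification_def by blast+

lemma modification_vcomp:
  assumes I: "two_category I" and "modification I A \<psi>" "modification I A \<phi>" "mdom \<psi> = mcod \<phi>"
  shows "modification I A (vcomp (two_fun_cat I A) \<psi> \<phi>)"
proof (rule modificationI[OF I])
  fix i assume i: "i \<in> Obj I"
  show "mcmp (vcomp (two_fun_cat I A) \<psi> \<phi>) i \<in> Cell A \<and>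
    dom2 A (mcmp (vcomp (two_fun_cat I A) \<psi> \<phi>) i) = tcmp (mdom (vcomp (two_fun_cat I A) \<psi> \<phi>)) i \<and>
    cod2 A (mcmp (vcomp (two_fun_cat I A) \<psi> \<phi>) i) = tcmp (mcod (vcomp (two_fun_cat I A) \<psi> \<phi>)) i"
    using modification_cmp[OF assms(2) i] modification_cmp[OF assms(3) i] assms(4) i
      vcomp_closed[of "mcmp \<psi> i" "mcmp \<phi> i"]
    by (simp add: two_fun_cat_def)
qed (use assms in \<open>simp_all add: two_fun_cat_def modification_def\<close>)

lemma modification_id:
  assumes I: "two_category I" and \<mu>: "two_natural I A \<mu>"
  shows "modification I A (id2 (two_fun_cat I A) \<mu>)"
proof (rule modificationI[OF I])
  fix i assume i: "i \<in> Obj I"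
  then have "tcmp \<mu> i \<in> Mor A"
    using \<mu> unfolding two_natural_def by blast
  from id2_closed[OF this] i
  show "mcmp (id2 (two_fun_cat I A) \<mu>) i \<in> Cell A \<and>
    dom2 A (mcmp (id2 (two_fun_cat I A) \<mu>) i) = tcmp (mdom (id2 (two_fun_cat I A) \<mu>)) i \<and>
    cod2 A (mcmp (id2 (two_fun_cat I A) \<mu>) i) = tcmp (mcod (id2 (two_fun_cat I A) \<mu>)) i"
    by (simp add: two_fun_cat_def)
qed (use \<mu> in \<open>simp_all add: two_fun_cat_def\<close>)

text \<open>Any modification in the opposite direction is an inverse: both composites are parallel
  to identities and hence equal to them.\<close>

lemma modification_invertible:
  assumes I: "two_category I" and \<phi>: "modification I A \<phi>"
  shows "invertible_cell (two_fun_cat I A) \<phi>"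
proof -
  let ?M = "two_fun_cat I A"
  have d: "Cell ?M = {\<phi>. modification I A \<phi>}" "dom2 ?M = mdom" "cod2 ?M = mcod"
    by (simp_all add: two_fun_cat_def)
  have n: "two_natural I A (mdom \<phi>)" "two_natural I A (mcod \<phi>)" "tdom (mcod \<phi>) = tdom (mdom \<phi>)"
    "tcod (mcod \<phi>) = tcod (mdom \<phi>)"
    using \<phi> unfolding modification_def by simp_all
  obtain \<psi> where \<psi>: "modification I A \<psi>" "mdom \<psi> = mcod \<phi>" "mcod \<psi> = mdom \<phi>"
    using modification_exists[OF I n(2,1,3,4)] .
  have "vcomp ?M \<psi> \<phi> = id2 ?M (mdom \<phi>)"
    by (rule modification_unique[OF modification_vcomp[OF I \<psi>(1) \<phi> \<psi>(2)] modification_id[OF I n(1)]])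
      (simp_all add: two_fun_cat_def \<psi>)
  moreover have "vcomp ?M \<phi> \<psi> = id2 ?M (mcod \<phi>)"
    by (rule modification_unique[OF modification_vcomp[OF I \<phi> \<psi>(1) \<psi>(3)[symmetric]] modification_id[OF I n(2)]])
      (simp_all add: two_fun_cat_def \<psi>)
  ultimately show ?thesis
    unfolding invertible_cell_def d using \<phi> \<psi> by blast
qed

end

section \<open>2-terminality in the pseudo-slice\<close>

lemma isomorphic_terminal_catI:
  assumes "Ob C = {x}" "Ar C = {f}" "Dom C f = x" "Cod C f = x" "Idt C x = f" "Cmp C f f = f"
  shows "isomorphic_cats C terminal_cat"
proof -
  have "is_cat_iso C terminal_cat (\<lambda>_. ()) (\<lambda>_. ())"
    unfolding is_cat_iso_def
  proof (intro conjI exI)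
    show "is_functor C terminal_cat (\<lambda>_. ()) (\<lambda>_. ())"
      by (simp add: is_functor_def terminal_cat_def)
    show "is_functor terminal_cat C (\<lambda>_. x) (\<lambda>_. f)"
      using assms by (simp add: is_functor_def)
  qed (use assms in \<open>simp_all add: terminal_cat_def\<close>)
  then show ?thesis
    unfolding isomorphic_cats_def by blast
qed

text \<open>A morphism into \<open>(l, lam)\<close> is a morphism \<open>u\<close> to
  \<open>l\<close> with an invertible modification. The first is unique by \<open>uniq\<close>; the
  second exists, is unique and is invertible by local indiscreteness. A 2-morphism from it to itself
  is carried by a 2-morphism from \<open>u\<close> to \<open>u\<close>, which can only be the
  identity.\<close>

lemma (in locally_indiscrete) pseudo_slice_terminal:
  assumes I: "two_category I" and lam: "two_cone I A F l lam"
    and uniq: "\<And>x \<mu>. two_cone I A F x \<mu> \<Longrightarrow> \<exists>!u. u \<in> Mor A \<and> dom1 A u = x \<and> cod1 A u = l"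
  shows "two_terminal (pseudo_slice I A F) (l, lam)"
proof -
  let ?M = "two_fun_cat I A" and ?S = "pseudo_slice I A F"
  have "isomorphic_cats (hom_cat ?S (x, \<mu>) (l, lam)) terminal_cat" if \<mu>: "two_cone I A F x \<mu>" for x \<mu>
  proof -
    obtain u where u: "u \<in> Mor A" "dom1 A u = x" "cod1 A u = l"
      and u': "\<And>v. v \<in> Mor A \<Longrightarrow> dom1 A v = x \<Longrightarrow> cod1 A v = l \<Longrightarrow> v = u"
      using uniq[OF \<mu>] by blast
    let ?lu = "transf_comp I A lam (diag_mor I A u)"
    have n: "two_natural I A ?lu" "two_natural I A \<mu>" "tdom ?lu = tdom \<mu>" "tcod ?lu = tcod \<mu>"
      using cone_comp[OF I lam \<mu> u] \<mu> lam u
      by (simp_all add: two_cone_def transf_comp_def diag_mor_def)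
    obtain \<phi> where \<phi>: "modification I A \<phi>" "mdom \<phi> = ?lu" "mcod \<phi> = \<mu>"
      using modification_exists[OF I n] .
    have d: "comp1 ?M = transf_comp I A" "dom2 ?M = mdom" "cod2 ?M = mcod" "Cell ?M = {\<phi>. modification I A \<phi>}"
      by (simp_all add: two_fun_cat_def)
    define m where "m = \<lparr>psdom = (x, \<mu>), pscod = (l, lam), psmor = u, psmodif = \<phi>\<rparr>"
    define c where "c = \<lparr>pscdom = m, psccod = m, pscell = id2 A u\<rparr>"
    note i = id2_closed[OF u(1)]
    have m: "m \<in> pseudo_slice_mor I A F"
      unfolding pseudo_slice_mor_def d m_def
      using \<mu> lam u modification_invertible[OF I \<phi>(1)] \<phi>(2,3) by blast
    have m_unique: "w = m" if w: "w \<in> pseudo_slice_mor I A F" "psdom w = (x, \<mu>)" "pscod w = (l, lam)" for w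
    proof -
      obtain f \<psi> where f: "w = \<lparr>psdom = (x, \<mu>), pscod = (l, lam), psmor = f, psmodif = \<psi>\<rparr>"
        "f \<in> Mor A" "dom1 A f = x" "cod1 A f = l" "invertible_cell ?M \<psi>"
        "mdom \<psi> = transf_comp I A lam (diag_mor I A f)" "mcod \<psi> = \<mu>"
        using w unfolding pseudo_slice_mor_def d by auto
      have fu: "f = u"
        using u' f(2-4) by blast
      have "\<psi> = \<phi>"
        using f(5) unfolding invertible_cell_def d
        by (intro modification_unique[OF _ \<phi>(1)]) (simp_all add: f(6,7) \<phi> fu)
      with fu f(1) show ?thesis
        by (simp add: m_def)
    qed
    \<comment> \<open>The pseudo-slice condition for the identity 2-morphism of \<open>u\<close>,
      needed so that \<open>c\<close> really is a 2-morphism of the pseudo-slice. The whiskered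
      identity has identity components, which disappear componentwise.\<close>
    have whisker: "vcomp ?M \<phi> (hcomp ?M (id2 ?M lam) (diag_cell I A (id2 A u))) = \<phi>"
    proof (rule modif.equality)
      show "mcmp (vcomp ?M \<phi> (hcomp ?M (id2 ?M lam) (diag_cell I A (id2 A u)))) = mcmp \<phi>"
      proof (rule extensionalityI[of _ "Obj I"])
        show "mcmp \<phi> \<in> extensional (Obj I)"
          using \<phi>(1) unfolding modification_def by blast
        fix j assume j: "j \<in> Obj I"
        have l: "tcmp lam j \<in> Mor A" "dom1 A (tcmp lam j) = l"
          using lam j unfolding two_cone_def two_natural_def diag_obj_def by auto
        have "id2 A (tcmp lam j) \<star> id2 A u = id2 A (tcmp lam j \<odot> u)"
          using l u by (intro hcomp_id2) simp_all
        moreover have "dom2 A (mcmp \<phi> j) = tcmp lam j \<odot> u"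
          using modification_cmp(2)[OF \<phi>(1) j] \<phi>(2) j by (simp add: transf_comp_def diag_mor_def)
        ultimately have "mcmp \<phi> j \<bullet> (id2 A (tcmp lam j) \<star> id2 A u) = mcmp \<phi> j"
          using vcomp_unit[OF modification_cmp(1)[OF \<phi>(1) j]] by simp
        then show "mcmp (vcomp ?M \<phi> (hcomp ?M (id2 ?M lam) (diag_cell I A (id2 A u)))) j = mcmp \<phi> j"
          using j by (simp add: two_fun_cat_def diag_cell_def)
      qed (simp add: two_fun_cat_def)
    qed (simp_all add: two_fun_cat_def diag_cell_def i \<phi>)
    have c: "c \<in> pseudo_slice_cell I A F"
      unfolding pseudo_slice_cell_def c_def using m whisker i by (auto simp: m_def)
    have c_unique: "t = c" if t: "t \<in> pseudo_slice_cell I A F" "psdom (pscdom t) = (x, \<mu>)" "pscod (pscdom t) = (l, lam)" for t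
    proof -
      obtain v w a where v: "t = \<lparr>pscdom = v, psccod = w, pscell = a\<rparr>"
        "v \<in> pseudo_slice_mor I A F" "w \<in> pseudo_slice_mor I A F" "psdom v = psdom w" "pscod v = pscod w"
        "a \<in> Cell A" "dom2 A a = psmor v" "cod2 A a = psmor w"
        using t(1) unfolding pseudo_slice_cell_def by blast
      have vw: "v = m" "w = m"
        using m_unique[OF v(2)] m_unique[OF v(3)] v(1,4,5) t(2,3) by simp_all
      have "a = id2 A u"
        using v(6-8) i by (intro cell_unique) (simp_all add: vw m_def)
      with v(1) vw show ?thesis
        by (simp add: c_def)
    qed
    show ?thesis
    proof (rule isomorphic_terminal_catI[of _ m c])
      show "Ob (hom_cat ?S (x, \<mu>) (l, lam)) = {m}"
      proof
        show "{m} \<subseteq> Ob (hom_cat ?S (x, \<mu>) (l, lam))"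
          using m by (simp add: hom_cat_def pseudo_slice_def m_def)
        show "Ob (hom_cat ?S (x, \<mu>) (l, lam)) \<subseteq> {m}"
          using m_unique by (auto simp: hom_cat_def pseudo_slice_def)
      qed
      show "Ar (hom_cat ?S (x, \<mu>) (l, lam)) = {c}"
      proof
        show "{c} \<subseteq> Ar (hom_cat ?S (x, \<mu>) (l, lam))"
          using c by (simp add: hom_cat_def pseudo_slice_def c_def m_def)
        show "Ar (hom_cat ?S (x, \<mu>) (l, lam)) \<subseteq> {c}"
          using c_unique by (auto simp: hom_cat_def pseudo_slice_def)
      qed
      have "id2 A u \<bullet> id2 A u = id2 A u"
        using vcomp_unit[of "id2 A u"] i by simp
      then show "Cmp (hom_cat ?S (x, \<mu>) (l, lam)) c c = c"
        by (simp add: hom_cat_def pseudo_slice_def c_def)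
    qed (simp_all add: hom_cat_def pseudo_slice_def c_def m_def)
  qed
  then show ?thesis
    using lam unfolding two_terminal_def by (auto simp: pseudo_slice_def)
qed

section \<open>Morphisms of the example\<close>

interpretation E: two_category ex_two_cat
  by (rule two_category_ex)

abbreviation ex_comp (infixr "\<cdot>" 75) where "g \<cdot> f \<equiv> g \<odot>\<^bsub>ex_two_cat\<^esub> f"

lemma ex_mtyp_gen:
  "mtyp ex_presentation (MGen mf) oX oL" "mtyp ex_presentation (MGen ml0) oL oB"
  "mtyp ex_presentation (MGen ml1) oL oC" "mtyp ex_presentation (MGen ma0) oX oB"
  "mtyp ex_presentation (MGen ma1) oX oC" "mtyp ex_presentation (MGen mb) oB oA"
  "mtyp ex_presentation (MGen mc) oC oA"
  using mtyp_gen[of mf ex_presentation] mtyp_gen[of ml0 ex_presentation]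
    mtyp_gen[of ml1 ex_presentation] mtyp_gen[of ma0 ex_presentation]
    mtyp_gen[of ma1 ex_presentation] mtyp_gen[of mb ex_presentation]
    mtyp_gen[of mc ex_presentation]
  by (simp_all add: ex_presentation_def)

lemma ex_gen_Mor [simp]: "ex_gen g \<in> Mor ex_two_cat"
  unfolding ex_gen_def ex_two_cat_def
  by (cases g) (blast intro: presented_MorI ex_mtyp_gen)+

lemma ex_gen_ends [simp]:
  "dom1 ex_two_cat (ex_gen mf) = oX" "cod1 ex_two_cat (ex_gen mf) = oL"
  "dom1 ex_two_cat (ex_gen ml0) = oL" "cod1 ex_two_cat (ex_gen ml0) = oB"
  "dom1 ex_two_cat (ex_gen ml1) = oL" "cod1 ex_two_cat (ex_gen ml1) = oC"
  "dom1 ex_two_cat (ex_gen ma0) = oX" "cod1 ex_two_cat (ex_gen ma0) = oB"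
  "dom1 ex_two_cat (ex_gen ma1) = oX" "cod1 ex_two_cat (ex_gen ma1) = oC"
  "dom1 ex_two_cat (ex_gen mb) = oB" "cod1 ex_two_cat (ex_gen mb) = oA"
  "dom1 ex_two_cat (ex_gen mc) = oC" "cod1 ex_two_cat (ex_gen mc) = oA"
  unfolding ex_gen_def ex_two_cat_def by (simp_all add: presented_dom1[OF ex_mtyp_gen(1)]
    presented_dom1[OF ex_mtyp_gen(2)] presented_dom1[OF ex_mtyp_gen(3)] presented_dom1[OF ex_mtyp_gen(4)]
    presented_dom1[OF ex_mtyp_gen(5)] presented_dom1[OF ex_mtyp_gen(6)] presented_dom1[OF ex_mtyp_gen(7)])

lemma ex_Obj [simp]: "x \<in> Obj ex_two_cat"
  by (simp add: ex_two_cat_def presented_Obj ex_presentation_def)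

lemma ex_id1 [simp]: "id1 ex_two_cat x \<in> Mor ex_two_cat"
  "dom1 ex_two_cat (id1 ex_two_cat x) = x" "cod1 ex_two_cat (id1 ex_two_cat x) = x"
  using E.id1_closed[of x] by simp_all

lemma ex_comp_closed [simp]:
  assumes "g \<in> Mor ex_two_cat" "f \<in> Mor ex_two_cat" "dom1 ex_two_cat g = cod1 ex_two_cat f"
  shows "g \<cdot> f \<in> Mor ex_two_cat" "dom1 ex_two_cat (g \<cdot> f) = dom1 ex_two_cat f"
    "cod1 ex_two_cat (g \<cdot> f) = cod1 ex_two_cat g"
  using E.comp1_closed[OF assms] by auto

lemma ex_comp_assoc [simp]:
  assumes "h \<in> Mor ex_two_cat" "g \<in> Mor ex_two_cat" "f \<in> Mor ex_two_cat"
    "dom1 ex_two_cat h = cod1 ex_two_cat g" "dom1 ex_two_cat g = cod1 ex_two_cat f"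
  shows "(h \<cdot> g) \<cdot> f = h \<cdot> g \<cdot> f"
  by (rule E.comp1_assoc[OF assms])

lemma ex_comp_id [simp]: "f \<in> Mor ex_two_cat \<Longrightarrow> cod1 ex_two_cat f = y \<Longrightarrow> id1 ex_two_cat y \<cdot> f = f"
  "f \<in> Mor ex_two_cat \<Longrightarrow> dom1 ex_two_cat f = x \<Longrightarrow> f \<cdot> id1 ex_two_cat x = f"
  using E.comp1_unit by blast+

lemma ex_gen_comp:
  assumes "mtyp ex_presentation (MGen g) y z" "mtyp ex_presentation (MGen h) x y"
  shows "ex_gen g \<cdot> ex_gen h = mclass ex_presentation (MComp (MGen g) (MGen h))"
  unfolding ex_gen_def ex_two_cat_def by (rule presented_comp1[OF assms])

text \<open>The orientation makes these rewrite rules: a composite ending in \<open>mc\<close> is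
  replaced by the one ending in \<open>mb\<close>.\<close>

lemma ex_relations [simp]:
  "ex_gen mc \<cdot> ex_gen ml1 = ex_gen mb \<cdot> ex_gen ml0"
  "ex_gen mc \<cdot> ex_gen ma1 = ex_gen mb \<cdot> ex_gen ma0"
proof -
  have "meq ex_presentation (MComp (MGen mc) (MGen ml1)) (MComp (MGen mb) (MGen ml0))"
    "meq ex_presentation (MComp (MGen mc) (MGen ma1)) (MComp (MGen mb) (MGen ma0))"
    by (rule meq_sym, rule meq_rel, simp add: ex_presentation_def,
        (rule mtyp_comp ex_mtyp_gen)+)+
  then show "ex_gen mc \<cdot> ex_gen ml1 = ex_gen mb \<cdot> ex_gen ml0"
    "ex_gen mc \<cdot> ex_gen ma1 = ex_gen mb \<cdot> ex_gen ma0"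
    by (simp_all add: ex_gen_comp[OF ex_mtyp_gen(6) ex_mtyp_gen(2)]
        ex_gen_comp[OF ex_mtyp_gen(7) ex_mtyp_gen(3)] ex_gen_comp[OF ex_mtyp_gen(6) ex_mtyp_gen(4)]
        ex_gen_comp[OF ex_mtyp_gen(7) ex_mtyp_gen(5)] mclass_eq)
qed

text \<open>\<open>ex_comp_assoc\<close> brackets to the right, which hides the left-hand side of
  the first rule once \<open>mf\<close> is composed in. This extra rule restores a common normal
  form.\<close>

lemma ex_relation_f [simp]:
  "ex_gen mc \<cdot> ex_gen ml1 \<cdot> ex_gen mf = ex_gen mb \<cdot> ex_gen ml0 \<cdot> ex_gen mf"
proof -
  have "ex_gen mc \<cdot> ex_gen ml1 \<cdot> ex_gen mf = (ex_gen mc \<cdot> ex_gen ml1) \<cdot> ex_gen mf"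
    by (subst ex_comp_assoc) simp_all
  also have "\<dots> = ex_gen mb \<cdot> ex_gen ml0 \<cdot> ex_gen mf"
    by simp
  finally show ?thesis .
qed

section \<open>An invariant separating parallel morphisms\<close>

fun alpha_count :: "(ex_obj, ex_mor) mterm \<Rightarrow> nat" where
  "alpha_count (MId x) = 0"
| "alpha_count (MGen g) = (if g = ma0 \<or> g = ma1 then 1 else 0)"
| "alpha_count (MComp s t) = alpha_count s + alpha_count t"

text \<open>Both sides of the first relation count 0 and both sides of the second count 1, because
  \<open>ma0\<close> and \<open>ma1\<close> are counted alike.\<close>

lemma alpha_count_cong: "meq ex_presentation u v \<Longrightarrow> alpha_count u = alpha_count v"
  by (induction rule: meq.induct) (auto simp: ex_presentation_def)

text \<open>The left-hand composites count 0 and the right-hand ones 1. The inequalities serve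
  twice: they let boundaries tell the 2-morphisms of a hom-category apart, and the first one refutes
  the limit property.\<close>

lemma ex_distinct:
  "ex_gen ml0 \<cdot> ex_gen mf \<noteq> ex_gen ma0" "ex_gen ml1 \<cdot> ex_gen mf \<noteq> ex_gen ma1"
  "ex_gen mb \<cdot> ex_gen ml0 \<cdot> ex_gen mf \<noteq> ex_gen mb \<cdot> ex_gen ma0"
proof -
  note c = presented_comp1[of ex_presentation, folded ex_two_cat_def]
  note t = ex_mtyp_gen mtyp_comp[OF ex_mtyp_gen(2,1)] mtyp_comp[OF ex_mtyp_gen(3,1)]
    mtyp_comp[OF ex_mtyp_gen(6,4)]
  have *: "mclass ex_presentation u \<noteq> mclass ex_presentation v"
    if "mtyp ex_presentation u x y" "alpha_count u \<noteq> alpha_count v" for u v x y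
    using mclass_eqD[OF _ that(1)] alpha_count_cong that(2) by blast
  show "ex_gen ml0 \<cdot> ex_gen mf \<noteq> ex_gen ma0" "ex_gen ml1 \<cdot> ex_gen mf \<noteq> ex_gen ma1"
    "ex_gen mb \<cdot> ex_gen ml0 \<cdot> ex_gen mf \<noteq> ex_gen mb \<cdot> ex_gen ma0"
    unfolding ex_gen_def
    by (simp_all add: c[OF t(2,1)] c[OF t(3,1)] c[OF t(6,8)] c[OF t(6,4)],
      (rule *, rule t mtyp_comp[OF t(6,8)], simp)+)
qed

section \<open>Enumeration of the morphisms\<close>

definition ex_hom :: "ex_obj \<Rightarrow> ex_obj \<Rightarrow> (ex_obj, ex_mor) mterm set set" where
  "ex_hom x y = (case (x, y) of
     (oX, oL) \<Rightarrow> {ex_gen mf}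
   | (oX, oB) \<Rightarrow> {ex_gen ml0 \<cdot> ex_gen mf, ex_gen ma0}
   | (oX, oC) \<Rightarrow> {ex_gen ml1 \<cdot> ex_gen mf, ex_gen ma1}
   | (oX, oA) \<Rightarrow> {ex_gen mb \<cdot> ex_gen ml0 \<cdot> ex_gen mf, ex_gen mb \<cdot> ex_gen ma0}
   | (oL, oB) \<Rightarrow> {ex_gen ml0}
   | (oL, oC) \<Rightarrow> {ex_gen ml1}
   | (oL, oA) \<Rightarrow> {ex_gen mb \<cdot> ex_gen ml0}
   | (oB, oA) \<Rightarrow> {ex_gen mb}
   | (oC, oA) \<Rightarrow> {ex_gen mc}
   | _ \<Rightarrow> if x = y then {id1 ex_two_cat x} else {})"

text \<open>A finite check over triples of objects, by rewriting to normal form. The relations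
  matter for the composites with \<open>mc\<close>, which must land among those listed with
  \<open>mb\<close>.\<close>

lemma ex_hom_comp: "g \<in> ex_hom y z \<Longrightarrow> f \<in> ex_hom x y \<Longrightarrow> g \<cdot> f \<in> ex_hom x z"
  by (cases x; cases y; cases z; simp add: ex_hom_def; elim disjE; simp)

lemma mclass_ex_hom: "mtyp ex_presentation t x y \<Longrightarrow> mclass ex_presentation t \<in> ex_hom x y"
proof (induction rule: mtyp.induct)
  case (mtyp_id x)
  then show ?case
    by (cases x) (simp_all add: ex_hom_def ex_two_cat_def presented_id1)
next
  case (mtyp_gen g)
  then show ?case
    by (cases g) (simp_all add: ex_presentation_def ex_hom_def ex_gen_def)
next
  case (mtyp_comp s y z t x)
  then show ?case
    using ex_hom_comp presented_comp1[OF mtyp_comp.hyps, folded ex_two_cat_def] by metis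
qed

text \<open>The list is complete because every morphism is the class of a typed term, and by
  induction on typing all such classes are listed.\<close>

lemma ex_hom_iff:
  "f \<in> ex_hom x y \<longleftrightarrow> f \<in> Mor ex_two_cat \<and> dom1 ex_two_cat f = x \<and> cod1 ex_two_cat f = y"
proof
  show "f \<in> ex_hom x y \<Longrightarrow> f \<in> Mor ex_two_cat \<and> dom1 ex_two_cat f = x \<and> cod1 ex_two_cat f = y"
    by (cases x; cases y; simp add: ex_hom_def; elim disjE; simp)
  show "f \<in> Mor ex_two_cat \<and> dom1 ex_two_cat f = x \<and> cod1 ex_two_cat f = y \<Longrightarrow> f \<in> ex_hom x y"
    unfolding ex_two_cat_def by (metis presented_MorE mclass_ex_hom)
qed

section \<open>2-morphisms of the example\<close>

abbreviation ex_vcomp (infixr "\<circ>\<^sub>v" 65) where "b \<circ>\<^sub>v a \<equiv> b \<bullet>\<^bsub>ex_two_cat\<^esub> a"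
abbreviation ex_hcomp (infixr "\<circ>\<^sub>h" 75) where "b \<circ>\<^sub>h a \<equiv> b \<star>\<^bsub>ex_two_cat\<^esub> a"
abbreviation ex_one ("\<one>") where "\<one> \<equiv> id2 ex_two_cat"

definition ex_cell_gen :: "ex_cell \<Rightarrow> (ex_obj, ex_mor, ex_cell) cterm set" where
  "ex_cell_gen h = cclass ex_presentation (CGen h)"

definition ex_cell_inv :: "ex_cell \<Rightarrow> (ex_obj, ex_mor, ex_cell) cterm set" where
  "ex_cell_inv h = cclass ex_presentation (CInv h)"

text \<open>Bundles the boundaries with the inverse laws so that the three hom-categories with two
  objects, from \<open>oX\<close> to \<open>oB\<close>, \<open>oC\<close> and \<open>oA\<close>, can
  be treated at once.\<close>

definition inverse_cells where
  "inverse_cells k k' p q \<longleftrightarrow> k \<in> Cell ex_two_cat \<and> k' \<in> Cell ex_two_cat \<and>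
     dom2 ex_two_cat k = p \<and> cod2 ex_two_cat k = q \<and> dom2 ex_two_cat k' = q \<and> cod2 ex_two_cat k' = p \<and>
     k' \<circ>\<^sub>v k = \<one> p \<and> k \<circ>\<^sub>v k' = \<one> q"

lemma inverse_cells_unique:
  assumes "inverse_cells k k' p q" "inverse_cells k k'' p q"
  shows "k' = k''"
  using assms E.vcomp_assoc[of k' k k''] E.vcomp_unit[of k'] E.vcomp_unit[of k'']
  unfolding inverse_cells_def by simp

lemma inverse_cells_whisker:
  assumes "inverse_cells k k' p q" "g \<in> Mor ex_two_cat" "dom1 ex_two_cat g = cod1 ex_two_cat p"
  shows "inverse_cells (\<one> g \<circ>\<^sub>h k) (\<one> g \<circ>\<^sub>h k') (g \<cdot> p) (g \<cdot> q)"
proof -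
  from assms have p: "p \<in> Mor ex_two_cat" "q \<in> Mor ex_two_cat" "cod1 ex_two_cat q = cod1 ex_two_cat p"
    using E.cell_ends unfolding inverse_cells_def by auto
  note i = E.id2_closed[OF assms(2)]
  \<comment> \<open>Splitting the identity of \<open>g\<close> as a vertical square is what lets
    interchange apply to the whiskered composites.\<close>
  have u: "\<one> g \<circ>\<^sub>v \<one> g = \<one> g"
    using E.vcomp_unit[of "\<one> g"] i by simp
  show ?thesis
    using assms p i u E.hcomp_closed[of "\<one> g" k] E.hcomp_closed[of "\<one> g" k']
      E.interchange[of "\<one> g" "\<one> g" k' k] E.interchange[of "\<one> g" "\<one> g" k k']
      E.hcomp_id2[of g p] E.hcomp_id2[of g q]
    unfolding inverse_cells_def by simp
qed

lemma ex_gen_ctyp: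
  "ctyp ex_presentation (CGen g0) (MComp (MGen ml0) (MGen mf)) (MGen ma0)"
  "ctyp ex_presentation (CGen g1) (MComp (MGen ml1) (MGen mf)) (MGen ma1)"
  "ctyp ex_presentation (CInv g0) (MGen ma0) (MComp (MGen ml0) (MGen mf))"
  "ctyp ex_presentation (CInv g1) (MGen ma1) (MComp (MGen ml1) (MGen mf))"
  using ctyp_gen[of g0 ex_presentation oX oB] ctyp_gen[of g1 ex_presentation oX oC]
    ctyp_inv[of g0 ex_presentation oX oB] ctyp_inv[of g1 ex_presentation oX oC]
    ex_mtyp_gen mtyp_comp[OF ex_mtyp_gen(2,1)] mtyp_comp[OF ex_mtyp_gen(3,1)]
  by (simp_all add: ex_presentation_def)

lemma ex_gen_boundary:
  "gen_src ex_presentation g0 = MComp (MGen ml0) (MGen mf)" "gen_tgt ex_presentation g0 = MGen ma0"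
  "gen_src ex_presentation g1 = MComp (MGen ml1) (MGen mf)" "gen_tgt ex_presentation g1 = MGen ma1"
  by (simp_all add: ex_presentation_def)

lemma inverse_cells_gen:
  "inverse_cells (ex_cell_gen g0) (ex_cell_inv g0) (ex_gen ml0 \<cdot> ex_gen mf) (ex_gen ma0)"
  "inverse_cells (ex_cell_gen g1) (ex_cell_inv g1) (ex_gen ml1 \<cdot> ex_gen mf) (ex_gen ma1)"
proof -
  have *: "inverse_cells (ex_cell_gen h) (ex_cell_inv h) (mclass ex_presentation u) (mclass ex_presentation v)"
    if hyps: "ctyp ex_presentation (CGen h) u v" "ctyp ex_presentation (CInv h) v u"
      "u = gen_src ex_presentation h" "v = gen_tgt ex_presentation h" for h u v
  proof -
    obtain x y where t: "mtyp ex_presentation u x y" "mtyp ex_presentation v x y"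
      using ctyp_par[OF hyps(1)] by blast
    show ?thesis
      unfolding inverse_cells_def ex_cell_gen_def ex_cell_inv_def ex_two_cat_def
      using presented_CellI[OF hyps(1)] presented_CellI[OF hyps(2)] presented_dom2[OF hyps(1)]
        presented_dom2[OF hyps(2)] presented_vcomp[OF hyps(1,2)] presented_vcomp[OF hyps(2,1)]
        presented_id2[OF t(1)] presented_id2[OF t(2)]
        cclass_eq[OF ceq_inv_left[OF hyps(2)]] cclass_eq[OF ceq_inv_right[OF hyps(2)]] hyps(3,4)
      by simp
  qed
  show "inverse_cells (ex_cell_gen g0) (ex_cell_inv g0) (ex_gen ml0 \<cdot> ex_gen mf) (ex_gen ma0)"
    "inverse_cells (ex_cell_gen g1) (ex_cell_inv g1) (ex_gen ml1 \<cdot> ex_gen mf) (ex_gen ma1)"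
    using *[OF ex_gen_ctyp(1,3)] *[OF ex_gen_ctyp(2,4)]
    by (simp_all add: ex_gen_comp[OF ex_mtyp_gen(2,1)] ex_gen_comp[OF ex_mtyp_gen(3,1)]
        ex_gen_boundary ex_gen_def[symmetric])
qed

lemma inverse_cells_b:
  "inverse_cells (\<one> (ex_gen mb) \<circ>\<^sub>h ex_cell_gen g0) (\<one> (ex_gen mb) \<circ>\<^sub>h ex_cell_inv g0)
     (ex_gen mb \<cdot> ex_gen ml0 \<cdot> ex_gen mf) (ex_gen mb \<cdot> ex_gen ma0)"
  by (rule inverse_cells_whisker[OF inverse_cells_gen(1)]) simp_all

text \<open>The first equation is the relation imposed in the presentation. The second follows by
  uniqueness of inverses: both sides invert the same whiskered 2-morphism.\<close>

lemma ex_cell_relation: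
  "\<one> (ex_gen mc) \<circ>\<^sub>h ex_cell_gen g1 = \<one> (ex_gen mb) \<circ>\<^sub>h ex_cell_gen g0"
  "\<one> (ex_gen mc) \<circ>\<^sub>h ex_cell_inv g1 = \<one> (ex_gen mb) \<circ>\<^sub>h ex_cell_inv g0"
proof -
  note t = ex_mtyp_gen(6,7) mtyp_comp[OF ex_mtyp_gen(2,1)] mtyp_comp[OF ex_mtyp_gen(3,1)]
  have b: "ctyp ex_presentation (HComp (CId (MGen mb)) (CGen g0))
      (MComp (MGen mb) (MComp (MGen ml0) (MGen mf))) (MComp (MGen mb) (MGen ma0))"
    by (rule ctyp_hcompI[OF ctyp_id[OF t(1)] ex_gen_ctyp(1) t(1,3)])
  have c: "ctyp ex_presentation (HComp (CId (MGen mc)) (CGen g1))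
      (MComp (MGen mc) (MComp (MGen ml1) (MGen mf))) (MComp (MGen mc) (MGen ma1))"
    by (rule ctyp_hcompI[OF ctyp_id[OF t(2)] ex_gen_ctyp(2) t(2,4)])
  note cc = presented_comp1[of ex_presentation, folded ex_two_cat_def]
  have m: "mclass ex_presentation (MComp (MGen mc) (MComp (MGen ml1) (MGen mf))) =
        mclass ex_presentation (MComp (MGen mb) (MComp (MGen ml0) (MGen mf)))"
      "mclass ex_presentation (MComp (MGen mc) (MGen ma1)) =
        mclass ex_presentation (MComp (MGen mb) (MGen ma0))"
    using ex_relations(2) ex_relation_f unfolding ex_gen_def
    by (simp_all add: cc[OF ex_mtyp_gen(3,1)] cc[OF ex_mtyp_gen(2,1)] cc[OF t(1,3)] cc[OF t(2,4)]
        cc[OF ex_mtyp_gen(7,5)] cc[OF ex_mtyp_gen(6,4)])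
  have "meq ex_presentation (MComp (MGen mc) (MComp (MGen ml1) (MGen mf)))
      (MComp (MGen mb) (MComp (MGen ml0) (MGen mf)))"
    "meq ex_presentation (MComp (MGen mc) (MGen ma1)) (MComp (MGen mb) (MGen ma0))"
    by (rule mclass_eqD[OF m(1)], rule mtyp_comp[OF t(2,4)], rule mclass_eqD[OF m(2)],
        rule mtyp_comp[OF ex_mtyp_gen(7,5)])
  \<comment> \<open>\<open>ceq_rel\<close> asks for one common boundary, while the two whiskered
    terms are typed by different representatives. Conversion along the relations between morphisms
    brings them together.\<close>
  then have c': "ctyp ex_presentation (HComp (CId (MGen mc)) (CGen g1))
      (MComp (MGen mb) (MComp (MGen ml0) (MGen mf))) (MComp (MGen mb) (MGen ma0))"
    by (rule ctyp_conv[OF c])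
  have "ceq ex_presentation (HComp (CId (MGen mb)) (CGen g0)) (HComp (CId (MGen mc)) (CGen g1))"
    by (rule ceq_rel[OF _ b c']) (simp add: ex_presentation_def)
  then show *: "\<one> (ex_gen mc) \<circ>\<^sub>h ex_cell_gen g1 = \<one> (ex_gen mb) \<circ>\<^sub>h ex_cell_gen g0"
    unfolding ex_gen_def ex_cell_gen_def ex_two_cat_def
    by (simp add: presented_id2[OF t(1)] presented_id2[OF t(2)] cclass_eq
        presented_hcomp[OF ctyp_id[OF t(1)] ex_gen_ctyp(1) t(1,3)]
        presented_hcomp[OF ctyp_id[OF t(2)] ex_gen_ctyp(2) t(2,4)])
  have "inverse_cells (\<one> (ex_gen mc) \<circ>\<^sub>h ex_cell_gen g1) (\<one> (ex_gen mc) \<circ>\<^sub>h ex_cell_inv g1)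
     (ex_gen mc \<cdot> ex_gen ml1 \<cdot> ex_gen mf) (ex_gen mc \<cdot> ex_gen ma1)"
    by (rule inverse_cells_whisker[OF inverse_cells_gen(2)]) simp_all
  then show "\<one> (ex_gen mc) \<circ>\<^sub>h ex_cell_inv g1 = \<one> (ex_gen mb) \<circ>\<^sub>h ex_cell_inv g0"
    using inverse_cells_b by (intro inverse_cells_unique) (simp_all add: *)
qed

section \<open>Enumeration of the 2-morphisms\<close>

text \<open>In the case from \<open>oX\<close> to \<open>oA\<close> only the whiskerings by
  \<open>mb\<close> are listed, since \<open>ex_cell_relation\<close> identifies those by
  \<open>mc\<close> with them.\<close>

definition ex_cells :: "ex_obj \<Rightarrow> ex_obj \<Rightarrow> (ex_obj, ex_mor, ex_cell) cterm set set" where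
  "ex_cells x y = \<one> ` ex_hom x y \<union> (case (x, y) of
     (oX, oB) \<Rightarrow> {ex_cell_gen g0, ex_cell_inv g0}
   | (oX, oC) \<Rightarrow> {ex_cell_gen g1, ex_cell_inv g1}
   | (oX, oA) \<Rightarrow> {\<one> (ex_gen mb) \<circ>\<^sub>h ex_cell_gen g0, \<one> (ex_gen mb) \<circ>\<^sub>h ex_cell_inv g0}
   | _ \<Rightarrow> {})"

context
  fixes k k' p q
  assumes inv: "inverse_cells k k' p q" and neq: "p \<noteq> q"
begin

lemma inverse_cells_ends:
  "p \<in> Mor ex_two_cat" "q \<in> Mor ex_two_cat"
  "dom2 ex_two_cat (\<one> p) = p" "cod2 ex_two_cat (\<one> p) = p"
  "dom2 ex_two_cat (\<one> q) = q" "cod2 ex_two_cat (\<one> q) = q"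
  "dom2 ex_two_cat k = p" "cod2 ex_two_cat k = q" "dom2 ex_two_cat k' = q" "cod2 ex_two_cat k' = p"
  "\<one> p \<in> Cell ex_two_cat" "\<one> q \<in> Cell ex_two_cat" "k \<in> Cell ex_two_cat" "k' \<in> Cell ex_two_cat"
proof -
  show "p \<in> Mor ex_two_cat" "q \<in> Mor ex_two_cat"
    using inv E.cell_ends[of k] by (simp_all add: inverse_cells_def)
  then show "dom2 ex_two_cat (\<one> p) = p" "cod2 ex_two_cat (\<one> p) = p"
    "dom2 ex_two_cat (\<one> q) = q" "cod2 ex_two_cat (\<one> q) = q"
    "\<one> p \<in> Cell ex_two_cat" "\<one> q \<in> Cell ex_two_cat"
    using E.id2_closed[of p] E.id2_closed[of q] by simp_all
qed (use inv in \<open>simp_all add: inverse_cells_def\<close>)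

lemma inverse_cells_vcomp:
  "k' \<circ>\<^sub>v k = \<one> p" "k \<circ>\<^sub>v k' = \<one> q" "\<one> p \<circ>\<^sub>v \<one> p = \<one> p" "\<one> q \<circ>\<^sub>v \<one> q = \<one> q"
  "\<one> q \<circ>\<^sub>v k = k" "k \<circ>\<^sub>v \<one> p = k" "\<one> p \<circ>\<^sub>v k' = k'" "k' \<circ>\<^sub>v \<one> q = k'"
  using inv E.vcomp_unit[OF inverse_cells_ends(11)] E.vcomp_unit[OF inverse_cells_ends(12)]
    E.vcomp_unit[OF inverse_cells_ends(13)] E.vcomp_unit[OF inverse_cells_ends(14)]
  by (simp_all add: inverse_cells_def inverse_cells_ends)

text \<open>As \<open>p \<noteq> q\<close>, the boundary condition leaves only the eight composable
  pairs evaluated in \<open>inverse_cells_vcomp\<close>.\<close>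

lemma inverse_cells_vcomp_closed:
  assumes "K \<in> {\<one> p, \<one> q, k, k'}" "K' \<in> {\<one> p, \<one> q, k, k'}"
    and "dom2 ex_two_cat K = cod2 ex_two_cat K'"
  shows "K \<circ>\<^sub>v K' \<in> {\<one> p, \<one> q, k, k'}"
  using assms neq neq[symmetric]
  by (elim insertE emptyE; simp only: inverse_cells_ends inverse_cells_vcomp insert_iff simp_thms)

text \<open>The four 2-morphisms realise the four ordered pairs of endpoints from \<open>p\<close>
  and \<open>q\<close>, and these pairs are distinct because \<open>p \<noteq> q\<close>.\<close>

lemma inverse_cells_parallel:
  assumes "K \<in> {\<one> p, \<one> q, k, k'}" "K' \<in> {\<one> p, \<one> q, k, k'}"
    and "dom2 ex_two_cat K = dom2 ex_two_cat K'" "cod2 ex_two_cat K = cod2 ex_two_cat K'"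
  shows "K = K'"
  using assms neq neq[symmetric] by (elim insertE emptyE; simp only: inverse_cells_ends simp_thms)

end

text \<open>Replaces the 25 pairs of objects by three shapes of hom-category: a freestanding
  isomorphism, a single identity, or nothing.\<close>

lemma ex_cells_cases:
  obtains (pair) k k' p q where "ex_cells x y = {\<one> p, \<one> q, k, k'}" "inverse_cells k k' p q"
      "p \<noteq> q" "ex_hom x y = {p, q}"
  | (single) p where "ex_cells x y = {\<one> p}" "ex_hom x y = {p}"
  | (none) "ex_cells x y = {}" "ex_hom x y = {}"
proof -
  consider "x = oX" "y = oB" | "x = oX" "y = oC" | "x = oX" "y = oA"
    | "\<exists>p. ex_cells x y = {\<one> p} \<and> ex_hom x y = {p}" | "ex_cells x y = {}" "ex_hom x y = {}"
    by (cases x; cases y; simp add: ex_cells_def ex_hom_def)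
  then show ?thesis
  proof cases
    case 1
    show ?thesis
      by (rule pair[OF _ inverse_cells_gen(1) ex_distinct(1)]) (simp_all add: 1 ex_cells_def ex_hom_def insert_commute)
  next
    case 2
    show ?thesis
      by (rule pair[OF _ inverse_cells_gen(2) ex_distinct(2)]) (simp_all add: 2 ex_cells_def ex_hom_def insert_commute)
  next
    case 3
    show ?thesis
      by (rule pair[OF _ inverse_cells_b ex_distinct(3)]) (simp_all add: 3 ex_cells_def ex_hom_def insert_commute)
  qed (use single none in blast)+
qed

lemma ex_cells_vcomp:
  assumes "K \<in> ex_cells x y" "K' \<in> ex_cells x y" "dom2 ex_two_cat K = cod2 ex_two_cat K'"
  shows "K \<circ>\<^sub>v K' \<in> ex_cells x y"
proof (cases rule: ex_cells_cases[of x y])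
  case (pair k k' p q)
  then show ?thesis
    using inverse_cells_vcomp_closed[of k k' p q K K'] assms by simp
next
  case (single p)
  then have "p \<in> Mor ex_two_cat"
    using ex_hom_iff[of p x y] by simp
  with single assms show ?thesis
    using E.vcomp_unit[of "\<one> p"] E.id2_closed[of p] by simp
qed (use assms in simp)

lemma ex_cells_parallel:
  assumes "K \<in> ex_cells x y" "K' \<in> ex_cells x y"
    "dom2 ex_two_cat K = dom2 ex_two_cat K'" "cod2 ex_two_cat K = cod2 ex_two_cat K'"
  shows "K = K'"
proof (cases rule: ex_cells_cases[of x y])
  case (pair k k' p q)
  then show ?thesis
    using inverse_cells_parallel[of k k' p q K K'] assms by simp
qed (use assms in simp_all)

lemma ex_cells_exists:
  assumes "u \<in> ex_hom x y" "v \<in> ex_hom x y"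
  shows "\<exists>K\<in>Cell ex_two_cat. dom2 ex_two_cat K = u \<and> cod2 ex_two_cat K = v"
proof (cases "u = v")
  case True
  then show ?thesis
    using assms E.id2_closed[of u] ex_hom_iff[of u x y] by blast
next
  case False
  show ?thesis
  proof (cases rule: ex_cells_cases[of x y])
    case (pair k k' p q)
    have "\<exists>K\<in>Cell ex_two_cat. dom2 ex_two_cat K = p \<and> cod2 ex_two_cat K = q"
      by (rule bexI[of _ k]) (simp_all add: inverse_cells_ends[OF pair(2,3)])
    moreover have "\<exists>K\<in>Cell ex_two_cat. dom2 ex_two_cat K = q \<and> cod2 ex_two_cat K = p"
      by (rule bexI[of _ k']) (simp_all add: inverse_cells_ends[OF pair(2,3)])
    ultimately show ?thesis
      using assms False unfolding pair(4) by auto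
  qed (use assms False in simp_all)
qed

lemma ex_cells_Cell:
  assumes "K \<in> ex_cells x y"
  shows "K \<in> Cell ex_two_cat" "dom1 ex_two_cat (dom2 ex_two_cat K) = x"
    "cod1 ex_two_cat (dom2 ex_two_cat K) = y"
proof -
  have "K \<in> Cell ex_two_cat \<and> dom2 ex_two_cat K \<in> ex_hom x y"
  proof (cases rule: ex_cells_cases[of x y])
    case (pair k k' p q)
    then have "K \<in> {\<one> p, \<one> q, k, k'}"
      using assms by simp
    then show ?thesis
      unfolding pair(4) by (elim insertE emptyE; simp only: inverse_cells_ends[OF pair(2,3)] insert_iff simp_thms)
  next
    case (single p)
    then have "p \<in> Mor ex_two_cat"
      using ex_hom_iff[of p x y] by simp
    with single assms show ?thesis
      using E.id2_closed[of p] by simp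
  qed (use assms in simp)
  then show "K \<in> Cell ex_two_cat" "dom1 ex_two_cat (dom2 ex_two_cat K) = x"
    "cod1 ex_two_cat (dom2 ex_two_cat K) = y"
    using ex_hom_iff[of "dom2 ex_two_cat K" x y] by simp_all
qed

text \<open>Listed 2-morphisms other than identities have source object \<open>oX\<close>, and only
  the identity morphism ends at \<open>oX\<close>. So if the left factor is one of them, the right
  factor is a unit. If the right factor is one, the left factor is a unit or the identity on
  \<open>mb\<close> or \<open>mc\<close>.\<close>

lemma ex_cells_hcomp:
  assumes K: "K \<in> ex_cells y z" and K': "K' \<in> ex_cells x y"
  shows "K \<circ>\<^sub>h K' \<in> ex_cells x z"
proof -
  note C = ex_cells_Cell[OF K] ex_cells_Cell[OF K']
  have id: "\<one> g \<circ>\<^sub>h \<one> f \<in> ex_cells x z" if "g \<in> ex_hom y z" "f \<in> ex_hom x y" for g f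
    using that ex_hom_comp[OF that] by (simp add: E.hcomp_id2 ex_hom_iff ex_cells_def)
  show ?thesis
  proof (cases "K \<in> \<one> ` ex_hom y z \<and> K' \<in> \<one> ` ex_hom x y")
    case True
    then show ?thesis
      using id by auto
  next
    case False
    then consider "K \<in> ex_cells y z - \<one> ` ex_hom y z" | "K' \<in> ex_cells x y - \<one> ` ex_hom x y"
      using assms by blast
    then show ?thesis
    proof cases
      case 1
      then have "y = oX"
        by (auto simp: ex_cells_def split: ex_obj.splits)
      with K' have "x = oX" "K' = \<one> (id1 ex_two_cat oX)" "y = oX"
        by (cases x; simp add: ex_cells_def ex_hom_def)+
      then show ?thesis
        using E.hcomp_unit[of K] C K by simp
    next
      case 2
      then have x: "x = oX" and y: "y \<in> {oA, oB, oC}"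
        by (auto simp: ex_cells_def split: ex_obj.splits)
      show ?thesis
      proof (cases "y = z")
        case True
        with K y have "K = \<one> (id1 ex_two_cat z)"
          by (auto simp: ex_cells_def ex_hom_def)
        then show ?thesis
          using E.hcomp_unit[of K'] C K' True by simp
      next
        case False
        \<comment> \<open>What remains is whiskering by \<open>mb\<close>, which is listed as it
          stands, and by \<open>mc\<close>, which \<open>ex_cell_relation\<close> turns into the
          former.\<close>
        with K y 2 x consider "y = oB" "z = oA" "K = \<one> (ex_gen mb)" "K' \<in> {ex_cell_gen g0, ex_cell_inv g0}"
          | "y = oC" "z = oA" "K = \<one> (ex_gen mc)" "K' \<in> {ex_cell_gen g1, ex_cell_inv g1}"
          by (cases z) (auto simp: ex_cells_def ex_hom_def)
        then show ?thesis
          using x by cases (auto simp: ex_cells_def ex_cell_relation)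
      qed
    qed
  qed
qed

text \<open>Induction on typing: the list contains identities, generators and formal inverses and is
  closed under both compositions. Conversion replaces a boundary by an equivalent term, which has
  the same end objects.\<close>

lemma cclass_ex_cells:
  "ctyp ex_presentation s u v \<Longrightarrow> mtyp ex_presentation u x y \<Longrightarrow> cclass ex_presentation s \<in> ex_cells x y"
proof (induction arbitrary: x y rule: ctyp.induct)
  case (ctyp_id u a b)
  then show ?case
    unfolding ex_cells_def presented_id2[OF ctyp_id.prems, folded ex_two_cat_def, symmetric]
    by (intro UnI1 imageI mclass_ex_hom)
next
  case (ctyp_gen h a b)
  show ?case
  proof (cases h)
    case g0
    then have "mtyp ex_presentation (MComp (MGen ml0) (MGen mf)) x y"
      using ctyp_gen.prems by (simp add: ex_gen_boundary)
    from mtyp_unique[OF this mtyp_comp[OF ex_mtyp_gen(2,1)]] show ?thesis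
      by (simp add: g0 ex_cells_def ex_cell_gen_def)
  next
    case g1
    then have "mtyp ex_presentation (MComp (MGen ml1) (MGen mf)) x y"
      using ctyp_gen.prems by (simp add: ex_gen_boundary)
    from mtyp_unique[OF this mtyp_comp[OF ex_mtyp_gen(3,1)]] show ?thesis
      by (simp add: g1 ex_cells_def ex_cell_gen_def)
  qed
next
  case (ctyp_inv h a b)
  show ?case
  proof (cases h)
    case g0
    then have "mtyp ex_presentation (MGen ma0) x y"
      using ctyp_inv.prems by (simp add: ex_gen_boundary)
    from mtyp_unique[OF this ex_mtyp_gen(4)] show ?thesis
      by (simp add: g0 ex_cells_def ex_cell_inv_def)
  next
    case g1
    then have "mtyp ex_presentation (MGen ma1) x y"
      using ctyp_inv.prems by (simp add: ex_gen_boundary)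
    from mtyp_unique[OF this ex_mtyp_gen(5)] show ?thesis
      by (simp add: g1 ex_cells_def ex_cell_inv_def)
  qed
next
  case (ctyp_vcomp s v w t u)
  have v: "mtyp ex_presentation v x y"
    using ctyp_par[OF ctyp_vcomp.hyps(2)] mtyp_unique[OF ctyp_vcomp.prems] by auto
  have "dom2 ex_two_cat (cclass ex_presentation s) = cod2 ex_two_cat (cclass ex_presentation t)"
    unfolding ex_two_cat_def presented_dom2[OF ctyp_vcomp.hyps(1)] presented_dom2[OF ctyp_vcomp.hyps(2)] ..
  from ex_cells_vcomp[OF ctyp_vcomp.IH(1)[OF v] ctyp_vcomp.IH(2)[OF ctyp_vcomp.prems] this]
  show ?case
    unfolding presented_vcomp[OF ctyp_vcomp.hyps, folded ex_two_cat_def] .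
next
  case (ctyp_hcomp s u u' t v v' a b)
  from ctyp_hcomp.prems obtain z where z: "mtyp ex_presentation u z y" "mtyp ex_presentation v x z"
    by (rule mtyp_compE)
  from ex_cells_hcomp[OF ctyp_hcomp.IH(1)[OF z(1)] ctyp_hcomp.IH(2)[OF z(2)]]
  show ?case
    unfolding presented_hcomp[OF ctyp_hcomp.hyps(1,2) z, folded ex_two_cat_def] .
next
  case (ctyp_conv t u v u' v')
  from ctyp_conv.IH[OF meq_mtyp'[OF ctyp_conv.hyps(2) ctyp_conv.prems]] show ?case .
qed

text \<open>Every 2-morphism is the class of a typed term, so it occurs in the list, where the
  boundary determines it.\<close>

lemma ex_Cell_unique:
  assumes "K \<in> Cell ex_two_cat" "K' \<in> Cell ex_two_cat"
    "dom2 ex_two_cat K = dom2 ex_two_cat K'" "cod2 ex_two_cat K = cod2 ex_two_cat K'"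
  shows "K = K'"
proof -
  have "K \<in> ex_cells (dom1 ex_two_cat (dom2 ex_two_cat K)) (cod1 ex_two_cat (dom2 ex_two_cat K))"
    if "K \<in> Cell ex_two_cat" for K
  proof -
    from that obtain t u v where t: "K = cclass ex_presentation t"
      "ctyp ex_presentation t u v"
      "mtyp ex_presentation u (dom1 ex_two_cat (dom2 ex_two_cat K)) (cod1 ex_two_cat (dom2 ex_two_cat K))"
      unfolding ex_two_cat_def by (rule presented_CellE)
    show ?thesis
      using cclass_ex_cells[OF t(2,3)] unfolding t(1) .
  qed
  from this[OF assms(1)] this[OF assms(2), folded assms(3)] assms(3,4) show ?thesis
    by (rule ex_cells_parallel)
qed

section \<open>Cones over the cospan\<close>

interpretation Ind: locally_indiscrete ex_two_cat
proof
  show "K = K'" if "K \<in> Cell ex_two_cat" "K' \<in> Cell ex_two_cat"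
    "dom2 ex_two_cat K = dom2 ex_two_cat K'" "cod2 ex_two_cat K = cod2 ex_two_cat K'" for K K'
    using that by (rule ex_Cell_unique)
  show "\<exists>K\<in>Cell ex_two_cat. dom2 ex_two_cat K = u \<and> cod2 ex_two_cat K = v"
    if "u \<in> Mor ex_two_cat" "v \<in> Mor ex_two_cat" "dom1 ex_two_cat u = dom1 ex_two_cat v"
      "cod1 ex_two_cat u = cod1 ex_two_cat v" for u v
    by (rule ex_cells_exists[of u "dom1 ex_two_cat u" "cod1 ex_two_cat u"])
      (simp_all add: that ex_hom_iff)
qed

lemma ex_shape_simps [simp]:
  "Obj ex_shape = UNIV" "Mor ex_shape = UNIV" "Cell ex_shape = UNIV"
  "dom1 ex_shape (SId i) = i" "dom1 ex_shape SBA = SB" "dom1 ex_shape SCA = SC"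
  "cod1 ex_shape (SId i) = i" "cod1 ex_shape SBA = SA" "cod1 ex_shape SCA = SA"
  "dom2 ex_shape f = f" "cod2 ex_shape f = f" "id1 ex_shape = SId" "comp1 ex_shape = shape_comp"
  "id2 ex_shape f = f" "vcomp ex_shape f g = f" "hcomp ex_shape = shape_comp"
  by (simp_all add: ex_shape_def discrete_two_cat_def pullback_shape_def)

lemma ex_id2 [simp]:
  assumes "f \<in> Mor ex_two_cat"
  shows "\<one> f \<in> Cell ex_two_cat" "dom2 ex_two_cat (\<one> f) = f" "cod2 ex_two_cat (\<one> f) = f"
    "\<one> f \<circ>\<^sub>v \<one> f = \<one> f"
  using E.id2_closed[OF assms] E.vcomp_unit[of "\<one> f"] by simp_all

text \<open>In the cospan shape every composable pair contains an identity, so preservation of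
  composites follows from that of identities. The 2-morphisms are all identities and are sent to
  identities.\<close>

lemma two_functor_ex_shapeI:
  assumes "\<And>f. M f \<in> Mor ex_two_cat" "\<And>f. dom1 ex_two_cat (M f) = O' (dom1 ex_shape f)"
    "\<And>f. cod1 ex_two_cat (M f) = O' (cod1 ex_shape f)" "\<And>i. M (SId i) = id1 ex_two_cat (O' i)"
  shows "two_functor ex_shape ex_two_cat \<lparr>on_obj = O', on_mor = M, on_cell = (\<lambda>f. \<one> (M f))\<rparr>"
proof -
  have comp: "M (shape_comp g f) = M g \<cdot> M f" if "dom1 ex_shape g = cod1 ex_shape f" for g f
    using that assms by (cases g; cases f) simp_all
  moreover have "\<one> (M (shape_comp g f)) = \<one> (M g) \<circ>\<^sub>h \<one> (M f)" if "dom1 ex_shape g = cod1 ex_shape f" for g f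
    using comp[OF that] E.hcomp_id2[of "M g" "M f"] that assms by simp
  ultimately show ?thesis
    using assms unfolding two_functor_def by (simp add: extensional_def)
qed

lemma two_functor_ex_diagram: "two_functor ex_shape ex_two_cat ex_diagram"
  unfolding ex_diagram_def
proof (rule two_functor_ex_shapeI)
  fix f
  show "ex_diagram_mor f \<in> Mor ex_two_cat"
    "dom1 ex_two_cat (ex_diagram_mor f) = ex_diagram_obj (dom1 ex_shape f)"
    "cod1 ex_two_cat (ex_diagram_mor f) = ex_diagram_obj (cod1 ex_shape f)"
    by (cases f; simp add: ex_diagram_mor_def ex_diagram_obj_def)+
qed (simp add: ex_diagram_mor_def)

lemma two_functor_ex_diag: "two_functor ex_shape ex_two_cat (diag_obj ex_shape ex_two_cat x)"
  using two_functor_ex_shapeI[of "\<lambda>_. id1 ex_two_cat x" "\<lambda>_. x"] by (simp add: diag_obj_def restrict_def)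

text \<open>A cone over a cospan is given by its two legs, the component at \<open>SA\<close> being
  forced by naturality. The encoding covers both the cone \<open>\<lambda>\<close> and the cone
  \<open>\<alpha>\<close>.\<close>

definition cospan_cone where
  "cospan_cone x p q = \<lparr>tdom = diag_obj ex_shape ex_two_cat x, tcod = ex_diagram,
     tcmp = (\<lambda>i. case i of SB \<Rightarrow> p | SC \<Rightarrow> q | SA \<Rightarrow> ex_gen mb \<cdot> p)\<rparr>"

lemma two_cone_cospan_cone:
  assumes p: "p \<in> Mor ex_two_cat" "dom1 ex_two_cat p = x" "cod1 ex_two_cat p = oB"
    and q: "q \<in> Mor ex_two_cat" "dom1 ex_two_cat q = x" "cod1 ex_two_cat q = oC"
    and pq: "ex_gen mb \<cdot> p = ex_gen mc \<cdot> q"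
  shows "two_cone ex_shape ex_two_cat ex_diagram x (cospan_cone x p q)"
proof -
  have "two_natural ex_shape ex_two_cat (cospan_cone x p q)"
  proof (rule Ind.two_naturalI[OF two_category_ex_shape])
    fix i
    show "tcmp (cospan_cone x p q) i \<in> Mor ex_two_cat \<and>
      dom1 ex_two_cat (tcmp (cospan_cone x p q) i) = on_obj (tdom (cospan_cone x p q)) i \<and>
      cod1 ex_two_cat (tcmp (cospan_cone x p q) i) = on_obj (tcod (cospan_cone x p q)) i"
      using p q by (cases i) (simp_all add: cospan_cone_def diag_obj_def ex_diagram_def ex_diagram_obj_def)
  next
    fix f
    have "ex_gen mb \<cdot> p \<in> Mor ex_two_cat" "dom1 ex_two_cat (ex_gen mb \<cdot> p) = x"
      "cod1 ex_two_cat (ex_gen mb \<cdot> p) = oA"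
      using p by simp_all
    then show "on_mor (tcod (cospan_cone x p q)) f \<cdot> tcmp (cospan_cone x p q) (dom1 ex_shape f) =
      tcmp (cospan_cone x p q) (cod1 ex_shape f) \<cdot> on_mor (tdom (cospan_cone x p q)) f"
      using p q pq by (cases f)
        (simp_all add: cospan_cone_def diag_obj_def ex_diagram_def ex_diagram_mor_def ex_diagram_obj_def
          split: shape_obj.split del: ex_comp_assoc)
  qed (simp_all add: cospan_cone_def two_functor_ex_diagram two_functor_ex_diag)
  then show ?thesis
    by (simp add: two_cone_def cospan_cone_def)
qed

lemma ex_cone_eq: "ex_cone = cospan_cone oL (ex_gen ml0) (ex_gen ml1)"
  by (simp add: ex_cone_def cospan_cone_def)

lemma ex_cone_two_cone: "two_cone ex_shape ex_two_cat ex_diagram oL ex_cone"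
  unfolding ex_cone_eq by (rule two_cone_cospan_cone) simp_all

text \<open>The apex must have morphisms to both \<open>oB\<close> and \<open>oC\<close>. This
  excludes \<open>oA\<close>, \<open>oB\<close> and \<open>oC\<close>, and each of the other two
  objects has exactly one morphism to \<open>oL\<close>.\<close>

lemma ex_cone_apex:
  assumes "two_cone ex_shape ex_two_cat ex_diagram x \<mu>"
  shows "\<exists>!u. u \<in> Mor ex_two_cat \<and> dom1 ex_two_cat u = x \<and> cod1 ex_two_cat u = oL"
proof -
  have "tcmp \<mu> i \<in> ex_hom x (ex_diagram_obj i)" for i
    using assms unfolding two_cone_def two_natural_def ex_hom_iff
    by (auto simp: diag_obj_def ex_diagram_def)
  from this[of SB] this[of SC] have "x \<in> {oX, oL}"
    by (cases x) (simp_all add: ex_diagram_obj_def ex_hom_def)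
  then have "\<exists>!u. u \<in> ex_hom x oL"
    by (auto simp: ex_hom_def)
  then show ?thesis
    by (simp only: ex_hom_iff)
qed

lemma ex_not_two_limit: "\<not> two_limit ex_shape ex_two_cat ex_diagram oL ex_cone"
proof
  let ?M = "two_fun_cat ex_shape ex_two_cat" and ?\<alpha> = "cospan_cone oX (ex_gen ma0) (ex_gen ma1)"
  assume "two_limit ex_shape ex_two_cat ex_diagram oL ex_cone"
  then have iso: "is_cat_iso (hom_cat ex_two_cat oX oL)
      (hom_cat ?M (diag_obj ex_shape ex_two_cat oX) ex_diagram)
      (\<lambda>f. ex_cone \<odot>\<^bsub>?M\<^esub> diag_mor ex_shape ex_two_cat f)
      (\<lambda>a. id2 ?M ex_cone \<star>\<^bsub>?M\<^esub> diag_cell ex_shape ex_two_cat a)"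
    unfolding two_limit_def using ex_Obj by blast
  have "two_cone ex_shape ex_two_cat ex_diagram oX ?\<alpha>"
    by (rule two_cone_cospan_cone) simp_all
  then have \<alpha>: "?\<alpha> \<in> Ob (hom_cat ?M (diag_obj ex_shape ex_two_cat oX) ex_diagram)"
    by (simp add: two_cone_def hom_cat_def two_fun_cat_def)
  from iso obtain K0 K1 where
    "is_functor (hom_cat ?M (diag_obj ex_shape ex_two_cat oX) ex_diagram) (hom_cat ex_two_cat oX oL) K0 K1"
    "\<forall>y\<in>Ob (hom_cat ?M (diag_obj ex_shape ex_two_cat oX) ex_diagram).
      ex_cone \<odot>\<^bsub>?M\<^esub> diag_mor ex_shape ex_two_cat (K0 y) = y"
    unfolding is_cat_iso_def by blast
  \<comment> \<open>The inverse functor makes post-composition surjective on objects, so the cone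
    \<open>\<alpha>\<close> would factor strictly through \<open>ex_cone\<close>. As
    \<open>mf\<close> is the only candidate, comparing the legs at \<open>SB\<close> gives the
    contradiction.\<close>
  with \<alpha> obtain u where u: "u \<in> Ob (hom_cat ex_two_cat oX oL)"
    "ex_cone \<odot>\<^bsub>?M\<^esub> diag_mor ex_shape ex_two_cat u = ?\<alpha>"
    unfolding is_functor_def by blast
  then have "u \<in> ex_hom oX oL"
    by (simp add: hom_cat_def ex_hom_iff)
  then have "u = ex_gen mf"
    by (simp add: ex_hom_def)
  with u(2) have "tcmp (ex_cone \<odot>\<^bsub>?M\<^esub> diag_mor ex_shape ex_two_cat (ex_gen mf)) SB = tcmp ?\<alpha> SB"
    by simp
  then have "ex_gen ml0 \<cdot> ex_gen mf = ex_gen ma0"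
    by (simp add: two_fun_cat_def transf_comp_def diag_mor_def ex_cone_def cospan_cone_def)
  then show False
    using ex_distinct(1) by simp
qed

theorem mainTheorem8:
  shows "two_terminal (pseudo_slice ex_shape ex_two_cat ex_diagram) (oL, ex_cone) \<and>
    \<not> two_limit ex_shape ex_two_cat ex_diagram oL ex_cone"
  using Ind.pseudo_slice_terminal[OF two_category_ex_shape ex_cone_two_cone ex_cone_apex]
    ex_not_two_limit by simp

end
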